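(* Let $u,v,w$ be nonconstant inner functions and let $\phi_1,\phi_2\in L^2$ be such that the operators $B^{v,w}_{\phi_1}$ and $B^{u,v}_{\phi_2}$ are bounded. Then the following are equivalent: (1) $B^{v,w}_{\phi_1}B^{u,v}_{\phi_2}\in\mathcal{T}(u,w)$; (2) $A^{\widehat{v},w}_{w\widehat{\phi_1}}A^{u,\widehat{v}}_{\overline{u\phi_2}}\in\mathcal{T}(u,w)$; (3) $A^{v,\widehat{w}}_{\overline{v\phi_1}}A^{\widehat{u},v}_{v\widehat{\phi_2}}\in\mathcal{T}(\widehat{u},\widehat{w})$; (4) $B^{v,w}_{\overline{v\widehat{w}\phi_1}}A^{\widehat{u},v}_{v\widehat{\phi_2}}\in\mathcal{H}(\widehat{u},w)$.
   Context: $L^2=L^2(\mathbb{T})$, $H^2\subset L^2$ is the Hardy space of the unit disk $\mathbb{D}$ (via boundary values), and $P:L^2\to H^2$ is the orthogonal projection. An inner function is $u\in H^2$ with $|u|=1$ a.e. on $\mathbb{T}$. The model space is $K_u=H^2\ominus uH^2$, and $P_u:L^2\to K_u$ is the orthogonal projection. For $f\in L^2$, $\widehat f(z)=\overline{f(\overline z)}$, $|z|=1$; if $u$ is inner, so is $\widehat u$. The flip operator is $J:L^2\to L^2$, $Jf(z)=\overline z f(\overline z)$, $|z|=1$. For inner functions $u,v$ and $\phi\in L^2$, the asymmetric truncated Toeplitz operator $A^{u,v}_\phi$ and the asymmetric truncated Hankel operator $B^{u,v}_\phi$ are the densely defined operators from $K_u$ into $K_v$ given by $A^{u,v}_\phi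 f=P_v(\phi f)$ and $B^{u,v}_\phi f=P_vJ(I-P)(\phi f)$ (defined at least on the bounded functions in $K_u$, which are dense; when bounded, they are extended to all of $K_u$). $\mathcal{T}(u,v)$ is the space of all bounded operators of the form $A^{u,v}_\phi$, $\phi\in L^2$, and $\mathcal{H}(u,v)$ is the space of all bounded operators of the form $B^{u,v}_\phi$, $\phi\in L^2$. *)

theory Defs
  imports "HOL-Analysis.Analysis"
begin

section \<open>The space L2 of the unit circle\<close>

text \<open>
  Normalised circle_measure length, as a measure whose space is the unit circle itself: values of a function
  off the circle (in particular its measurability there) play no role.
\<close>

definition circle_measure :: "complex measure" where
  "circle_measure = distr (uniform_measure lborel {-pi..pi}) (restrict_space borel (sphere 0 1)) cis"

definition sqint :: "(complex \<Rightarrow> complex) \<Rightarrow> bool" where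
  "sqint f \<longleftrightarrow> f \<in> borel_measurable circle_measure \<and> integrable circle_measure (\<lambda>z. (norm (f z))\<^sup>2)"

definition L2_rel :: "(complex \<Rightarrow> complex) \<Rightarrow> (complex \<Rightarrow> complex) \<Rightarrow> bool" where
  "L2_rel f g \<longleftrightarrow> sqint f \<and> sqint g \<and> (AE z in circle_measure. f z = g z)"

lemma cis_measurable_circle [measurable]:
  "cis \<in> measurable (uniform_measure lborel {-pi..pi}) (restrict_space borel (sphere 0 1))"
proof -
  have "cis \<in> borel_measurable borel"
    by (intro borel_measurable_continuous_onI continuous_intros)
  then show ?thesis
    by (intro measurable_restrict_space2) auto
qed

lemma space_circle [simp]: "space circle_measure = sphere 0 1"
  by (simp add: circle_measure_def space_restrict_space)

lemma sets_circle: "sets circle_measure = sets (restrict_space borel (sphere 0 1))"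
  by (simp add: circle_measure_def)

lemma prob_circle: "emeasure circle_measure (space circle_measure) = 1"
proof -
  have "emeasure (lborel::real measure) {-pi..pi} = ennreal (2*pi)"
    by (simp add: emeasure_lborel_Icc)
  then have "emeasure (uniform_measure lborel {-pi..pi}) (space (uniform_measure lborel {-pi..pi})) = 1"
    by (subst emeasure_uniform_measure) (auto simp: ennreal_divide_self)
  moreover have "emeasure circle_measure (space circle_measure)
      = emeasure (uniform_measure lborel {-pi..pi})
          (cis -` space circle_measure \<inter> space (uniform_measure lborel {-pi..pi}))"
    unfolding circle_measure_def space_distr
    by (rule emeasure_distr[OF cis_measurable_circle sets.top])
  moreover have "cis -` space circle_measure = UNIV"
    by auto
  ultimately show ?thesis by simp
qed

lemma finite_measure_circle: "finite_measure circle_measure"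
  by (rule finite_measureI) (simp add: prob_circle del: space_circle)

interpretation circle_measure: finite_measure circle_measure
  by (rule finite_measure_circle)

lemma distr_uminus_uniform:
  "distr (uniform_measure lborel {-pi..pi}) borel uminus = uniform_measure lborel {-pi..pi}"
proof (rule measure_eqI)
  fix A :: "real set" assume "A \<in> sets (distr (uniform_measure lborel {-pi..pi}) borel uminus)"
  then have A [measurable]: "A \<in> sets borel" by simp
  have "emeasure lborel ({-pi..pi} \<inter> A) = emeasure (distr lborel borel uminus) ({-pi..pi} \<inter> A)"
    by (simp add: lborel_distr_uminus)
  also have "\<dots> = emeasure lborel (uminus -` ({-pi..pi} \<inter> A))"
    by (subst emeasure_distr) auto
  also have "uminus -` ({-pi..pi} \<inter> A) = {-pi..pi} \<inter> uminus -` A"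
    by auto
  finally show "emeasure (distr (uniform_measure lborel {-pi..pi}) borel uminus) A
      = emeasure (uniform_measure lborel {-pi..pi}) A"
    using measurable_sets[of uminus borel borel A]
    by (subst emeasure_distr) (auto simp: vimage_def)
qed simp

lemma cnj_measurable_circle [measurable]: "cnj \<in> measurable circle_measure circle_measure"
proof -
  have "cnj \<in> borel_measurable borel"
    by (intro borel_measurable_continuous_onI continuous_intros)
  then have "cnj \<in> measurable (restrict_space borel (sphere 0 1)) (restrict_space borel (sphere 0 1))"
    by (intro measurable_restrict_space3) auto
  then show ?thesis
    by (simp cong: measurable_cong_sets add: sets_circle)
qed

lemma distr_cnj_circle: "distr circle_measure circle_measure cnj = circle_measure"
proof -
  let ?U = "uniform_measure lborel {-pi..pi}"
  let ?S = "restrict_space borel (sphere 0 1) :: complex measure"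
  have cnj: "cnj \<in> measurable ?S ?S"
    using cnj_measurable_circle by (simp cong: measurable_cong_sets add: sets_circle)
  have um: "uminus \<in> measurable ?U borel"
    by simp
  have cisb: "cis \<in> measurable borel ?S"
    using cis_measurable_circle by (simp cong: measurable_cong_sets)
  have "distr circle_measure circle_measure cnj = distr circle_measure ?S cnj"
    by (rule distr_cong) (simp_all add: sets_circle)
  also have "\<dots> = distr ?U ?S (cnj \<circ> cis)"
    unfolding circle_measure_def by (rule distr_distr[OF cnj cis_measurable_circle])
  also have "cnj \<circ> cis = cis \<circ> uminus"
    by (auto simp: cis_cnj)
  also have "distr ?U ?S (cis \<circ> uminus) = distr (distr ?U borel uminus) ?S cis"
    by (rule distr_distr[OF cisb um, symmetric])
  also have "\<dots> = circle_measure"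
    by (simp add: distr_uminus_uniform circle_measure_def)
  finally show ?thesis .
qed

lemma AE_circle_cnj:
  assumes "AE z in circle_measure. P z" shows "AE z in circle_measure. P (cnj z)"
proof -
  have "AE z in distr circle_measure circle_measure cnj. P z"
    unfolding distr_cnj_circle by (rule assms)
  then show ?thesis by (rule AE_distrD[OF cnj_measurable_circle])
qed

lemma ident_measurable_circle [measurable]: "(\<lambda>z. z) \<in> borel_measurable circle_measure"
  by (simp cong: measurable_cong_sets add: sets_circle measurable_restrict_space1)

lemma sqint_measurable [measurable_dest]: "sqint f \<Longrightarrow> f \<in> borel_measurable circle_measure"
  by (simp add: sqint_def)

lemma sqint_bound:
  assumes "sqint f" "sqint g" "h \<in> borel_measurable circle_measure"
    "\<And>z. (norm (h z))\<^sup>2 \<le> C * ((norm (f z))\<^sup>2 + (norm (g z))\<^sup>2)"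
  shows "sqint h"
proof -
  have "integrable circle_measure (\<lambda>z. C * ((norm (f z))\<^sup>2 + (norm (g z))\<^sup>2))"
    using assms(1,2) by (auto simp: sqint_def)
  then have "integrable circle_measure (\<lambda>z. (norm (h z))\<^sup>2)"
    by (rule Bochner_Integration.integrable_bound)
      (use assms(3) in measurable, use order.trans[OF assms(4) abs_ge_self] in simp)
  then show ?thesis using assms(3) by (simp add: sqint_def)
qed

lemma sqint_const: "sqint (\<lambda>_. c)"
  by (simp add: sqint_def)

lemma norm_add_sq_le: "(norm (a + b))\<^sup>2 \<le> 2 * ((norm a)\<^sup>2 + (norm b)\<^sup>2)"
  for a b :: complex
proof -
  have "(norm (a + b))\<^sup>2 \<le> (norm a + norm b)\<^sup>2"
    by (intro power_mono norm_triangle_ineq norm_ge_zero)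
  also have "\<dots> \<le> 2 * ((norm a)\<^sup>2 + (norm b)\<^sup>2)"
    using sum_squares_bound[of "norm a" "norm b"] by (simp add: power2_sum)
  finally show ?thesis .
qed

lemma sqint_add: "sqint f \<Longrightarrow> sqint g \<Longrightarrow> sqint (\<lambda>z. f z + g z)"
  by (rule sqint_bound[of f g _ 2]) (use norm_add_sq_le in \<open>auto simp: sqint_def\<close>)

lemma sqint_cscale: "sqint f \<Longrightarrow> sqint (\<lambda>z. c * f z)"
  by (rule sqint_bound[of f f _ "(norm c)\<^sup>2"]) (auto simp: norm_mult power_mult_distrib algebra_simps)

lemma sqint_diff: "sqint f \<Longrightarrow> sqint g \<Longrightarrow> sqint (\<lambda>z. f z - g z)"
  using sqint_add[of f "\<lambda>z. (-1) * g z"] sqint_cscale[of g "-1"] by simp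

lemma sqint_cnj: "sqint f \<Longrightarrow> sqint (\<lambda>z. cnj (f z))"
proof -
  assume f: "sqint f"
  have "cnj \<in> borel_measurable borel"
    by (intro borel_measurable_continuous_onI continuous_intros)
  with f have "(\<lambda>z. cnj (f z)) \<in> borel_measurable circle_measure"
    by (auto intro: measurable_compose)
  with f show ?thesis by (simp add: sqint_def)
qed

lemma sqint_reflect: "sqint f \<Longrightarrow> sqint (\<lambda>z. f (cnj z))"
proof -
  assume f: "sqint f"
  then have m: "(\<lambda>z. f (cnj z)) \<in> borel_measurable circle_measure"
    by (auto intro: measurable_compose[OF cnj_measurable_circle])
  have "integrable (distr circle_measure circle_measure cnj) (\<lambda>z. (norm (f z))\<^sup>2)"
    using f by (simp add: distr_cnj_circle sqint_def)
  then have "integrable circle_measure (\<lambda>z. (norm (f (cnj z)))\<^sup>2)"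
    by (rule integrable_distr[OF cnj_measurable_circle])
  with m show ?thesis by (simp add: sqint_def)
qed

lemma sqint_cnj_ident_mult: "sqint f \<Longrightarrow> sqint (\<lambda>z. cnj z * f z)"
proof -
  assume f: "sqint f"
  have "cnj \<in> borel_measurable borel"
    by (intro borel_measurable_continuous_onI continuous_intros)
  then have c: "cnj \<in> borel_measurable circle_measure"
    using measurable_compose[OF ident_measurable_circle] by blast
  have "integrable circle_measure (\<lambda>z. (norm (cnj z * f z))\<^sup>2) \<longleftrightarrow> integrable circle_measure (\<lambda>z. (norm (f z))\<^sup>2)"
    by (rule Bochner_Integration.integrable_cong) (auto simp: norm_mult)
  moreover have "(\<lambda>z. cnj z * f z) \<in> borel_measurable circle_measure"
    using f c by (intro borel_measurable_times) (auto simp: sqint_def)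
  ultimately show ?thesis using f unfolding sqint_def by blast
qed

lemma sqint_mult_integrable:
  assumes "sqint f" "sqint g" shows "integrable circle_measure (\<lambda>z. f z * cnj (g z))"
proof -
  have g: "sqint (\<lambda>z. cnj (g z))" by (rule sqint_cnj[OF assms(2)])
  have "integrable circle_measure (\<lambda>z. (norm (f z))\<^sup>2 + (norm (g z))\<^sup>2)"
    using assms by (auto simp: sqint_def)
  then show ?thesis
  proof (rule Bochner_Integration.integrable_bound)
    show "(\<lambda>z. f z * cnj (g z)) \<in> borel_measurable circle_measure"
      using assms(1) g by (auto simp: sqint_def)
    have "norm (f z * cnj (g z)) \<le> norm ((norm (f z))\<^sup>2 + (norm (g z))\<^sup>2)" for z
    proof -
      have "0 \<le> norm (f z) * norm (g z)" by simp
      then have "norm (f z) * norm (g z) \<le> (norm (f z))\<^sup>2 + (norm (g z))\<^sup>2"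
        using sum_squares_bound[of "norm (f z)" "norm (g z)"] by linarith
      then show ?thesis by (simp add: norm_mult)
    qed
    then show "AE z in circle_measure. norm (f z * cnj (g z)) \<le> norm ((norm (f z))\<^sup>2 + (norm (g z))\<^sup>2)"
      by simp
  qed
qed

quotient_type L2 = "complex \<Rightarrow> complex" / partial: L2_rel
proof (rule part_equivpI)
  show "\<exists>x. L2_rel x x"
    by (rule exI[of _ "\<lambda>_. 0"]) (simp add: L2_rel_def sqint_const)
  show "symp L2_rel"
    by (rule sympI) (auto simp: L2_rel_def)
  show "transp L2_rel"
    by (rule transpI) (auto simp: L2_rel_def)
qed

lift_definition cscale :: "complex \<Rightarrow> L2 \<Rightarrow> L2" is "\<lambda>c f z. c * f z"
  by (auto simp: L2_rel_def sqint_cscale)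

lift_definition cinner :: "L2 \<Rightarrow> L2 \<Rightarrow> complex" is "\<lambda>f g. \<integral>z. f z * cnj (g z) \<partial>circle_measure"
proof -
  fix f f' g g' assume *: "L2_rel f f'" "L2_rel g g'"
  then show "(\<integral>z. f z * cnj (g z) \<partial>circle_measure) = (\<integral>z. f' z * cnj (g' z) \<partial>circle_measure)"
    by (intro integral_cong_AE borel_measurable_integrable sqint_mult_integrable)
      (auto simp: L2_rel_def)
qed

instantiation L2 :: real_inner
begin

lift_definition zero_L2 :: L2 is "\<lambda>_. 0"
  by (simp add: L2_rel_def sqint_const)

lift_definition plus_L2 :: "L2 \<Rightarrow> L2 \<Rightarrow> L2" is "\<lambda>f g z. f z + g z"
  by (auto simp: L2_rel_def sqint_add)

lift_definition minus_L2 :: "L2 \<Rightarrow> L2 \<Rightarrow> L2" is "\<lambda>f g z. f z - g z"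
  by (auto simp: L2_rel_def sqint_diff)

definition uminus_L2 :: "L2 \<Rightarrow> L2" where
  "uminus_L2 f = cscale (-1) f"

definition scaleR_L2 :: "real \<Rightarrow> L2 \<Rightarrow> L2" where
  "scaleR_L2 r f = cscale (of_real r) f"

definition inner_L2 :: "L2 \<Rightarrow> L2 \<Rightarrow> real" where
  "inner_L2 f g = Re (cinner f g)"

definition norm_L2 :: "L2 \<Rightarrow> real" where
  "norm_L2 f = sqrt (Re (cinner f f))"

definition dist_L2 :: "L2 \<Rightarrow> L2 \<Rightarrow> real" where
  "dist_L2 f g = norm (f - g)"

definition sgn_L2 :: "L2 \<Rightarrow> L2" where
  "sgn_L2 f = scaleR (inverse (norm f)) f"

definition uniformity_L2 :: "(L2 \<times> L2) filter" where
  "uniformity_L2 = (INF e\<in>{0 <..}. principal {(x, y). dist x y < e})"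

definition open_L2 :: "L2 set \<Rightarrow> bool" where
  "open_L2 U \<longleftrightarrow> (\<forall>x\<in>U. eventually (\<lambda>(x', y). x' = x \<longrightarrow> y \<in> U) uniformity)"

lemma cinner_self: "sqint f \<Longrightarrow> (\<integral>z. f z * cnj (f z) \<partial>circle_measure) = of_real (\<integral>z. (norm (f z))\<^sup>2 \<partial>circle_measure)"
  by (simp flip: complex_norm_square integral_complex_of_real)

instance
proof
  fix f g h :: L2 and a b :: real
  show "f + g + h = f + (g + h)"
    by transfer (auto simp: L2_rel_def algebra_simps sqint_add)
  show "f + g = g + f"
    by transfer (auto simp: L2_rel_def algebra_simps sqint_add)
  show "0 + f = f"
    by transfer (auto simp: L2_rel_def)
  show "- f + f = 0"
    unfolding uminus_L2_def
    by transfer (auto simp: L2_rel_def sqint_const)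
  show "f - g = f + - g"
    unfolding uminus_L2_def
    by transfer (auto simp: L2_rel_def intro: sqint_diff)
  show "a *\<^sub>R (f + g) = a *\<^sub>R f + a *\<^sub>R g"
    unfolding scaleR_L2_def
    by transfer (auto simp: L2_rel_def distrib_left intro!: sqint_add sqint_cscale)
  show "(a + b) *\<^sub>R f = a *\<^sub>R f + b *\<^sub>R f"
    unfolding scaleR_L2_def
    by transfer (auto simp: L2_rel_def distrib_right intro!: sqint_add sqint_cscale)
  show "a *\<^sub>R b *\<^sub>R f = (a * b) *\<^sub>R f"
    unfolding scaleR_L2_def
    by transfer (auto simp: L2_rel_def mult.assoc intro!: sqint_cscale)
  show "1 *\<^sub>R f = f"
    unfolding scaleR_L2_def by transfer (auto simp: L2_rel_def)
  show "dist f g = norm (f - g)" by (rule dist_L2_def)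
  show "sgn f = scaleR (inverse (norm f)) f" by (rule sgn_L2_def)
  show "uniformity = (INF e\<in>{0 <..}. principal {(x, y :: L2). dist x y < e})"
    by (rule uniformity_L2_def)
  show "open U \<longleftrightarrow> (\<forall>x\<in>U. eventually (\<lambda>(x', y). x' = x \<longrightarrow> y \<in> U) uniformity)" for U :: "L2 set"
    by (rule open_L2_def)
  have "cinner f g = cnj (cinner g f)"
    by transfer (simp add: mult.commute flip: Bochner_Integration.integral_cnj)
  then show "inner f g = inner g f"
    by (simp add: inner_L2_def)
  have "cinner (f + g) h = cinner f h + cinner g h"
    by transfer (auto simp: L2_rel_def algebra_simps sqint_mult_integrable)
  then show "inner (f + g) h = inner f h + inner g h"
    by (simp add: inner_L2_def)
  have "cinner (cscale (of_real a) f) g = of_real a * cinner f g"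
    by transfer (auto simp: L2_rel_def mult.assoc)
  then show "inner (a *\<^sub>R f) g = a * inner f g"
    by (simp add: inner_L2_def scaleR_L2_def)
  show "0 \<le> inner f f"
    unfolding inner_L2_def
    by transfer (auto simp: L2_rel_def cinner_self)
  have "(Re (cinner f f) = 0) = (f = 0)"
    by transfer (auto simp: L2_rel_def cinner_self sqint_const integral_nonneg_eq_0_iff_AE sqint_def)
  then show "(inner f f = 0) = (f = 0)"
    by (simp add: inner_L2_def)
  show "norm f = sqrt (inner f f)"
    by (simp add: inner_L2_def norm_L2_def)
qed

end

text \<open>The class of a function, with the junk value 0 if the function is not square integrable.\<close>

lift_definition L2_of :: "(complex \<Rightarrow> complex) \<Rightarrow> L2" is "\<lambda>f. if sqint f then f else (\<lambda>_. 0)"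
  by (auto simp: L2_rel_def sqint_const)

lift_definition conjugate :: "L2 \<Rightarrow> L2" is "\<lambda>f z. cnj (f z)"
  by (auto simp: L2_rel_def sqint_cnj)

lift_definition hat :: "L2 \<Rightarrow> L2" is "\<lambda>f z. cnj (f (cnj z))"
proof -
  fix f g assume "L2_rel f g"
  then show "L2_rel (\<lambda>z. cnj (f (cnj z))) (\<lambda>z. cnj (g (cnj z)))"
    using AE_circle_cnj[of "\<lambda>z. f z = g z"] by (auto simp: L2_rel_def intro!: sqint_cnj sqint_reflect)
qed

lift_definition flip :: "L2 \<Rightarrow> L2" is "\<lambda>f z. cnj z * f (cnj z)"
proof -
  fix f g assume "L2_rel f g"
  then show "L2_rel (\<lambda>z. cnj z * f (cnj z)) (\<lambda>z. cnj z * g (cnj z))"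
    using AE_circle_cnj[of "\<lambda>z. f z = g z"]
    by (auto simp: L2_rel_def sqint_cnj_ident_mult[OF sqint_reflect])
qed

text \<open>
  The pointwise product, with the junk value 0 when the product is not square integrable.
  Below, one factor is always essentially bounded, so that this case does not arise.
\<close>

lift_definition L2_mult :: "L2 \<Rightarrow> L2 \<Rightarrow> L2"  (infixl "\<odot>" 70)
  is "\<lambda>f g. if sqint (\<lambda>z. f z * g z) then (\<lambda>z. f z * g z) else (\<lambda>_. 0)"
proof -
  fix f f' g g' assume *: "L2_rel f f'" "L2_rel g g'"
  then have m: "(\<lambda>z. f z * g z) \<in> borel_measurable circle_measure" "(\<lambda>z. f' z * g' z) \<in> borel_measurable circle_measure"
    by (auto simp: L2_rel_def sqint_def)
  have ae: "AE z in circle_measure. f z * g z = f' z * g' z"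
    using * by (auto simp: L2_rel_def)
  have "integrable circle_measure (\<lambda>z. (norm (f z * g z))\<^sup>2) \<longleftrightarrow> integrable circle_measure (\<lambda>z. (norm (f' z * g' z))\<^sup>2)"
    using m ae by (intro integrable_cong_AE) auto
  then have "sqint (\<lambda>z. f z * g z) \<longleftrightarrow> sqint (\<lambda>z. f' z * g' z)"
    using m by (simp add: sqint_def)
  then show "L2_rel (if sqint (\<lambda>z. f z * g z) then (\<lambda>z. f z * g z) else (\<lambda>_. 0))
      (if sqint (\<lambda>z. f' z * g' z) then (\<lambda>z. f' z * g' z) else (\<lambda>_. 0))"
    using ae by (auto simp: L2_rel_def sqint_const)
qed

lift_definition ess_bounded :: "L2 \<Rightarrow> bool" is "\<lambda>f. \<exists>C. AE z in circle_measure. norm (f z) \<le> C"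
proof -
  fix f g assume *: "L2_rel f g"
  have "(AE z in circle_measure. norm (f z) \<le> C) \<longleftrightarrow> (AE z in circle_measure. norm (g z) \<le> C)" for C
    using * unfolding L2_rel_def by (auto elim: AE_mp)
  then show "(\<exists>C. AE z in circle_measure. norm (f z) \<le> C) \<longleftrightarrow> (\<exists>C. AE z in circle_measure. norm (g z) \<le> C)"
    by simp
qed

lift_definition unimodular :: "L2 \<Rightarrow> bool" is "\<lambda>f. AE z in circle_measure. norm (f z) = 1"
  by (auto simp: L2_rel_def)

section \<open>Hardy space, inner functions and model spaces\<close>

definition hardy_disc :: "(complex \<Rightarrow> complex) \<Rightarrow> bool" where
  "hardy_disc F \<longleftrightarrow> F holomorphic_on ball 0 1 \<and>
     (\<exists>C. \<forall>r\<in>{0..<1}. (\<integral>z. (norm (F (of_real r * z)))\<^sup>2 \<partial>circle_measure) \<le> C)"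

text \<open>Boundary values are taken in quadratic mean: the dilates of F converge to f in L2.\<close>

definition H2 :: "L2 set" where
  "H2 = {f. \<exists>F. hardy_disc F \<and> ((\<lambda>r. L2_of (\<lambda>z. F (of_real r * z))) \<longlongrightarrow> f) (at_left (1::real))}"

definition inner_fun :: "L2 \<Rightarrow> bool" where
  "inner_fun u \<longleftrightarrow> u \<in> H2 \<and> unimodular u"

definition nonconstant :: "L2 \<Rightarrow> bool" where
  "nonconstant u \<longleftrightarrow> (\<forall>c. u \<noteq> L2_of (\<lambda>_. c))"

definition model_space :: "L2 \<Rightarrow> L2 set" where
  "model_space u = {f \<in> H2. \<forall>g\<in>H2. cinner f (u \<odot> g) = 0}"

definition orth_proj :: "L2 set \<Rightarrow> L2 \<Rightarrow> L2" where
  "orth_proj M f = (THE g. g \<in> M \<and> (\<forall>h\<in>M. cinner (f - g) h = 0))"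

section \<open>Asymmetric truncated Toeplitz and Hankel operators\<close>

text \<open>
  A densely defined operator from one model space to another is represented by a map on L2, of
  which only the values on the bounded functions in its source matter.
\<close>

definition bounded_part :: "L2 \<Rightarrow> L2 set" where
  "bounded_part u = {f \<in> model_space u. ess_bounded f}"

definition toeplitz_formula :: "L2 \<Rightarrow> L2 \<Rightarrow> L2 \<Rightarrow> L2" where
  "toeplitz_formula v \<phi> f = orth_proj (model_space v) (\<phi> \<odot> f)"

definition hankel_formula :: "L2 \<Rightarrow> L2 \<Rightarrow> L2 \<Rightarrow> L2" where
  "hankel_formula v \<phi> f = orth_proj (model_space v) (flip (\<phi> \<odot> f - orth_proj H2 (\<phi> \<odot> f)))"

definition bounded_on :: "L2 \<Rightarrow> (L2 \<Rightarrow> L2) \<Rightarrow> bool" where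
  "bounded_on u D \<longleftrightarrow> (\<exists>C. \<forall>f\<in>bounded_part u. norm (D f) \<le> C * norm f)"

text \<open>
  Bounded operators between model spaces are represented by maps on L2 that vanish off the source,
  so that equality of maps is equality of operators and composition of maps is composition of
  operators.
\<close>

definition bounded_operator :: "L2 \<Rightarrow> L2 \<Rightarrow> (L2 \<Rightarrow> L2) \<Rightarrow> bool" where
  "bounded_operator u v T \<longleftrightarrow>
     (\<forall>f\<in>model_space u. T f \<in> model_space v) \<and>
     (\<forall>f\<in>model_space u. \<forall>g\<in>model_space u. T (f + g) = T f + T g) \<and>
     (\<forall>c. \<forall>f\<in>model_space u. T (cscale c f) = cscale c (T f)) \<and>
     (\<exists>C. \<forall>f\<in>model_space u. norm (T f) \<le> C * norm f) \<and>
     (\<forall>f. f \<notin> model_space u \<longrightarrow> T f = 0)"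

definition bounded_extension :: "L2 \<Rightarrow> L2 \<Rightarrow> (L2 \<Rightarrow> L2) \<Rightarrow> L2 \<Rightarrow> L2" where
  "bounded_extension u v D = (THE T. bounded_operator u v T \<and> (\<forall>f\<in>bounded_part u. T f = D f))"

definition A_bounded :: "L2 \<Rightarrow> L2 \<Rightarrow> L2 \<Rightarrow> bool" where
  "A_bounded u v \<phi> \<longleftrightarrow> bounded_on u (toeplitz_formula v \<phi>)"

definition B_bounded :: "L2 \<Rightarrow> L2 \<Rightarrow> L2 \<Rightarrow> bool" where
  "B_bounded u v \<phi> \<longleftrightarrow> bounded_on u (hankel_formula v \<phi>)"

text \<open>The following two are meaningful only for bounded operators.\<close>

definition A_op :: "L2 \<Rightarrow> L2 \<Rightarrow> L2 \<Rightarrow> L2 \<Rightarrow> L2" where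
  "A_op u v \<phi> = bounded_extension u v (toeplitz_formula v \<phi>)"

definition B_op :: "L2 \<Rightarrow> L2 \<Rightarrow> L2 \<Rightarrow> L2 \<Rightarrow> L2" where
  "B_op u v \<phi> = bounded_extension u v (hankel_formula v \<phi>)"

definition T_space :: "L2 \<Rightarrow> L2 \<Rightarrow> (L2 \<Rightarrow> L2) set" where
  "T_space u v = {A_op u v \<phi> | \<phi>. A_bounded u v \<phi>}"

definition H_space :: "L2 \<Rightarrow> L2 \<Rightarrow> (L2 \<Rightarrow> L2) set" where
  "H_space u v = {B_op u v \<phi> | \<phi>. B_bounded u v \<phi>}"

end

theory Submission
  imports Defs "HOL-Complex_Analysis.Cauchy_Integral_Formula"
begin

text \<open>
  The unitary $f \mapsto \widehat u\, J f$ and the antiunitary $f \mapsto \widehat f$ both map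
  $K_u$ onto $K_{\widehat u}$ and intertwine the projections. Hence composing with the former on
  either side exchanges truncated Toeplitz and truncated Hankel operators, and conjugating by the latter
  preserves truncated Toeplitz operators. Writing $X$ for the product in (1), the products in (2), (3) and (4)
  are obtained from $X$ by such compositions.
\<close>

section \<open>Inner product and norm\<close>

text \<open>The maps inserted around the two Hankel factors cancel over the middle space K_v; only
  maps at the outer ends survive, and these act bijectively between the operator spaces. Nothing
  about X itself enters.

  The obstacle is that \<open>A_op\<close> and \<open>B_op\<close> are defined by
  \<open>THE\<close>, as extensions of formulas that make sense only on bounded functions. Every
  relation is therefore first an identity of formulas, valid for arbitrary L2 symbols, and then
  carried over to the extensions. Uniqueness of the extension needs density of the bounded functions
  in K_u, which comes from an explicit projection and completeness of the characters; existence
  needs completeness of L2.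

  The definition of H2 by boundary values serves only to identify H2 with the vanishing of the
  negative Fourier coefficients. Afterwards everything is computed on frequencies, where J sends n
  to -n-1. Since a product that is not square integrable defaults to 0, products are regrouped only
  around unimodular factors.\<close>

lemma L2_exhaust:
  obtains f where "sqint f" "F = L2_of f"
proof -
  have "\<exists>f. sqint f \<and> F = L2_of f"
    by transfer (auto simp: L2_rel_def)
  then show ?thesis using that by blast
qed

lemma L2_of_eq_iff:
  assumes "sqint f" "sqint g"
  shows "L2_of f = L2_of g \<longleftrightarrow> (AE z in circle_measure. f z = g z)"
  using assms by transfer (auto simp: L2_rel_def)

lemma L2_of_add: "sqint f \<Longrightarrow> sqint g \<Longrightarrow> L2_of (\<lambda>z. f z + g z) = L2_of f + L2_of g"
  by transfer (auto simp: L2_rel_def sqint_add)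

lemma L2_of_diff: "sqint f \<Longrightarrow> sqint g \<Longrightarrow> L2_of (\<lambda>z. f z - g z) = L2_of f - L2_of g"
  by transfer (auto simp: L2_rel_def sqint_diff)

lemma L2_of_cscale: "sqint f \<Longrightarrow> L2_of (\<lambda>z. c * f z) = cscale c (L2_of f)"
  by transfer (auto simp: L2_rel_def sqint_cscale)

lemma cinner_L2_of: "sqint f \<Longrightarrow> sqint g \<Longrightarrow> cinner (L2_of f) (L2_of g) = (\<integral>z. f z * cnj (g z) \<partial>circle_measure)"
  by transfer auto

lemma cinner_commute: "cinner g f = cnj (cinner f g)"
  by transfer (simp add: mult.commute flip: Bochner_Integration.integral_cnj)

lemma cinner_add_left: "cinner (f + g) h = cinner f h + cinner g h"
  by transfer (auto simp: L2_rel_def algebra_simps sqint_mult_integrable)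

lemma cinner_cscale_left: "cinner (cscale c f) g = c * cinner f g"
  by transfer (auto simp: L2_rel_def mult.assoc)

lemma cinner_diff_left: "cinner (f - g) h = cinner f h - cinner g h"
  by transfer (auto simp: L2_rel_def algebra_simps sqint_mult_integrable)

lemma cinner_add_right: "cinner h (f + g) = cinner h f + cinner h g"
  by (subst (1 2 3) cinner_commute) (simp add: cinner_add_left)

lemma cinner_diff_right: "cinner h (f - g) = cinner h f - cinner h g"
  by (subst (1 2 3) cinner_commute) (simp add: cinner_diff_left)

lemma cinner_cscale_right: "cinner g (cscale c f) = cnj c * cinner g f"
  by (subst (1 2) cinner_commute) (simp add: cinner_cscale_left)

lemma cinner_zero_left [simp]: "cinner 0 f = 0"
  using cinner_diff_left[of 0 0 f] by simp

lemma cinner_zero_right [simp]: "cinner f 0 = 0"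
  using cinner_diff_right[of f 0 0] by simp

lemma cinner_self: "cinner f f = complex_of_real ((norm f)\<^sup>2)"
proof -
  have "cnj (cinner f f) = cinner f f"
    using cinner_commute[of f f] by simp
  then have "Im (cinner f f) = 0"
    by (simp add: complex_eq_iff)
  moreover have "(norm f)\<^sup>2 = Re (cinner f f)"
    by (simp add: power2_norm_eq_inner inner_L2_def)
  ultimately show ?thesis
    by (simp add: complex_eq_iff)
qed

lemma cinner_self_eq_0: "cinner f f = 0 \<longleftrightarrow> f = 0"
  by (simp add: cinner_self)

lemma norm_L2_of: "sqint f \<Longrightarrow> (norm (L2_of f))\<^sup>2 = (\<integral>z. (norm (f z))\<^sup>2 \<partial>circle_measure)"
  using cinner_self[of "L2_of f"] by (simp add: cinner_L2_of Defs.cinner_self flip: of_real_power)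

lemma norm_cscale [simp]: "norm (cscale c f) = cmod c * norm f"
proof -
  have "complex_of_real ((norm (cscale c f))\<^sup>2) = c * (cnj c * cinner f f)"
    unfolding cinner_self[of "cscale c f", symmetric] by (simp add: cinner_cscale_left cinner_cscale_right mult.left_commute)
  also have "\<dots> = complex_of_real ((cmod c * norm f)\<^sup>2)"
    by (simp add: cinner_self power_mult_distrib mult.assoc[symmetric] flip: complex_norm_square)
  finally show ?thesis
    by (simp only: of_real_eq_iff power2_eq_iff_nonneg[OF norm_ge_zero mult_nonneg_nonneg[OF norm_ge_zero norm_ge_zero]])
qed

text \<open>Rotating f by the unimodular constant c makes the inner product real and nonnegative,
  which leaves the Cauchy-Schwarz inequality of the real inner product.\<close>

lemma norm_cinner_le: "cmod (cinner f g) \<le> norm f * norm g"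
proof (cases "cinner f g = 0")
  case False
  define c where "c = cnj (cinner f g) / cmod (cinner f g)"
  have "cmod c = 1"
    using False by (simp add: c_def norm_divide)
  have "cinner (cscale c f) g = cmod (cinner f g)"
    using False complex_norm_square[of "cinner f g"]
    by (simp add: cinner_cscale_left c_def mult.commute[of "cnj _"] power2_eq_square field_simps)
  then have "cmod (cinner f g) = inner (cscale c f) g"
    by (simp add: inner_L2_def)
  also have "\<dots> \<le> norm (cscale c f) * norm g"
    by (rule norm_cauchy_schwarz)
  finally show ?thesis using \<open>cmod c = 1\<close> by simp
qed simp

lemma cscale_add_right: "cscale c (f + g) = cscale c f + cscale c g"
  by transfer (auto simp: L2_rel_def distrib_left intro!: sqint_add sqint_cscale)

lemma cscale_diff_right: "cscale c (f - g) = cscale c f - cscale c g"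
  by transfer (auto simp: L2_rel_def right_diff_distrib intro!: sqint_diff sqint_cscale)

lemma cscale_cscale [simp]: "cscale a (cscale b f) = cscale (a * b) f"
  by transfer (auto simp: L2_rel_def mult.assoc intro!: sqint_cscale)

lemma cscale_one [simp]: "cscale 1 f = f"
  by transfer (auto simp: L2_rel_def)

lemma cscale_zero [simp]: "cscale 0 f = 0" "cscale c 0 = 0"
  by (transfer, auto simp: L2_rel_def sqint_const)+

lemma bounded_linear_cscale: "bounded_linear (cscale c)"
  by (rule bounded_linear_intro[of _ "cmod c"])
    (auto simp: cscale_add_right scaleR_L2_def mult.commute)

lemma bounded_linear_cinner_left: "bounded_linear (\<lambda>f. cinner f g)"
  by (rule bounded_linear_intro[of _ "norm g"])
    (auto simp: cinner_add_left scaleR_L2_def cinner_cscale_left scaleR_conv_of_real norm_cinner_le)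

lemma bounded_linear_cinner_right: "bounded_linear (\<lambda>f. cinner g f)"
  by (rule bounded_linear_intro[of _ "norm g"])
    (auto simp: cinner_add_right scaleR_L2_def cinner_cscale_right scaleR_conv_of_real
      norm_cinner_le mult.commute[of "norm _" "norm g"])

lemmas tendsto_cinner_left = bounded_linear.tendsto[OF bounded_linear_cinner_left]

section \<open>Completeness\<close>

text \<open>Riesz-Fischer: on a finite measure space a sequence that is Cauchy in L2 is Cauchy in
  L1, hence has an almost everywhere convergent subsequence, and Fatou's lemma shows that the whole
  sequence tends to its pointwise limit in L2.\<close>

instance L2 :: complete_space
proof
  fix X :: "nat \<Rightarrow> L2" assume X: "Cauchy X"
  have "\<exists>x. \<forall>n. sqint (x n) \<and> X n = L2_of (x n)"
    by (intro choice allI) (metis L2_exhaust)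
  then obtain x where x: "\<And>n. sqint (x n)" "\<And>n. X n = L2_of (x n)" by blast
  note [measurable] = sqint_measurable[OF x(1)]
  have nrm: "(norm (X i - X j))\<^sup>2 = (\<integral>z. (norm (x i z - x j z))\<^sup>2 \<partial>circle_measure)" for i j
    using norm_L2_of[OF sqint_diff[OF x(1) x(1)], of i j] by (simp add: x L2_of_diff)
  have int1: "integrable circle_measure f" if "sqint f" for f
    using sqint_mult_integrable[OF that sqint_const[of 1]] by simp
  \<comment> \<open>Cauchy-Schwarz against the constant 1, whose norm is 1 because the measure is
    normalised.\<close>
  have L1: "(\<integral>z. norm (f z) \<partial>circle_measure) \<le> norm (L2_of f)" if f: "sqint f" for f
  proof -
    have n: "sqint (\<lambda>z. complex_of_real (norm (f z)))"
      using f by (auto simp: sqint_def)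
    have "cmod (cinner (L2_of (\<lambda>z. complex_of_real (norm (f z)))) (L2_of (\<lambda>_. 1)))
      \<le> norm (L2_of (\<lambda>z. complex_of_real (norm (f z)))) * norm (L2_of (\<lambda>_. 1))"
      by (rule norm_cinner_le)
    also have "norm (L2_of (\<lambda>z. complex_of_real (norm (f z)))) = norm (L2_of f)"
      by (rule power2_eq_imp_eq) (simp_all add: norm_L2_of n f)
    also have "(norm (L2_of (\<lambda>_. 1)))\<^sup>2 = 1"
      using prob_circle by (simp add: norm_L2_of sqint_const measure_def)
    then have "norm (L2_of (\<lambda>_. 1)) = 1"
      by (metis norm_ge_zero abs_of_nonneg real_sqrt_abs real_sqrt_one)
    finally show ?thesis
      by (simp add: cinner_L2_of n sqint_const)
  qed
  have "\<exists>N. \<forall>i\<ge>N. \<forall>j\<ge>N. (\<integral>z. norm (x i z - x j z) \<partial>circle_measure) < e" if "e > 0" for e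
  proof -
    obtain N where "\<forall>i\<ge>N. \<forall>j\<ge>N. norm (X i - X j) < e"
      using CauchyD[OF X \<open>e > 0\<close>] by blast
    then show ?thesis
      using L1[OF sqint_diff[OF x(1) x(1)]]
      by (intro exI[of _ N] allI impI le_less_trans[OF L1[OF sqint_diff[OF x(1) x(1)]]]) (simp add: x L2_of_diff)
  qed
  then obtain r where r: "strict_mono r" "AE z in circle_measure. Cauchy (\<lambda>i. x (r i) z)"
    using cauchy_L1_AE_cauchy_subseq[of circle_measure x] int1 x(1) by blast
  define f where "f z = lim (\<lambda>i. x (r i) z)" for z
  have [measurable]: "f \<in> borel_measurable circle_measure"
    unfolding f_def by measurable
  have lim: "AE z in circle_measure. (\<lambda>i. x (r i) z) \<longlonglongrightarrow> f z"
    using r(2) by eventually_elim (auto simp: f_def Cauchy_convergent_iff convergent_LIMSEQ_iff)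
  \<comment> \<open>Fatou along the subsequence bounds the distance from f to x n for every n beyond
    N, not only for the members of the subsequence. Square integrability of f itself then follows by
    adding some x n back.\<close>
  have fatou: "sqint (\<lambda>z. f z - x n z) \<and> norm (L2_of (\<lambda>z. f z - x n z)) \<le> e"
    if "e > 0" and N: "\<forall>i\<ge>N. \<forall>j\<ge>N. norm (X i - X j) < e" and "n \<ge> N" for e N n
  proof -
    have "(\<integral>\<^sup>+z. ennreal ((norm (f z - x n z))\<^sup>2) \<partial>circle_measure)
      = (\<integral>\<^sup>+z. liminf (\<lambda>i. ennreal ((norm (x (r i) z - x n z))\<^sup>2)) \<partial>circle_measure)"
    proof (rule nn_integral_cong_AE)
      show "AE z in circle_measure. ennreal ((norm (f z - x n z))\<^sup>2)
        = liminf (\<lambda>i. ennreal ((norm (x (r i) z - x n z))\<^sup>2))"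
        using lim
      proof eventually_elim
        case (elim z)
        have "(\<lambda>i. ennreal ((norm (x (r i) z - x n z))\<^sup>2)) \<longlonglongrightarrow> ennreal ((norm (f z - x n z))\<^sup>2)"
          by (intro tendsto_ennrealI tendsto_intros elim)
        then show ?case
          by (intro lim_imp_Liminf[symmetric]) simp_all
      qed
    qed
    also have "\<dots> \<le> liminf (\<lambda>i. \<integral>\<^sup>+z. ennreal ((norm (x (r i) z - x n z))\<^sup>2) \<partial>circle_measure)"
      by (rule nn_integral_liminf) measurable
    also have "\<dots> = liminf (\<lambda>i. ennreal ((norm (X (r i) - X n))\<^sup>2))"
      unfolding nrm using sqint_diff[OF x(1) x(1)]
      by (subst nn_integral_eq_integral) (auto simp: sqint_def)
    also have "\<dots> \<le> ennreal (e\<^sup>2)"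
    proof (rule Liminf_le)
      have "norm (X (r i) - X n) \<le> e" if "i \<ge> N" for i
        using N \<open>n \<ge> N\<close> that seq_suble[OF r(1), of i] by (meson le_trans less_imp_le)
      then have "\<forall>\<^sub>F i in sequentially. ennreal ((norm (X (r i) - X n))\<^sup>2) \<le> ennreal (e\<^sup>2)"
        by (auto intro!: eventually_sequentiallyI[of N] ennreal_leI power_mono)
      then show "\<forall>\<^sub>F i in sequentially. ennreal ((norm (X (r i) - X n))\<^sup>2) \<le> ennreal (e\<^sup>2)" .
    qed simp
    finally have le: "(\<integral>\<^sup>+z. ennreal ((norm (f z - x n z))\<^sup>2) \<partial>circle_measure) \<le> ennreal (e\<^sup>2)" .
    then have "(\<integral>\<^sup>+z. ennreal ((norm (f z - x n z))\<^sup>2) \<partial>circle_measure) < \<infinity>"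
      by (rule le_less_trans) simp
    then have int: "integrable circle_measure (\<lambda>z. (norm (f z - x n z))\<^sup>2)"
      by (intro integrableI_nonneg) auto
    then have sq: "sqint (\<lambda>z. f z - x n z)"
      by (simp add: sqint_def)
    have "ennreal ((norm (L2_of (\<lambda>z. f z - x n z)))\<^sup>2) \<le> ennreal (e\<^sup>2)"
      using le int by (simp add: norm_L2_of sq nn_integral_eq_integral)
    then show ?thesis
      using sq \<open>e > 0\<close> by (simp add: power2_le_iff_abs_le)
  qed
  have CX: "\<exists>N. \<forall>i\<ge>N. \<forall>j\<ge>N. norm (X i - X j) < e" if "e > 0" for e
    using CauchyD[OF X that] .
  obtain n where "sqint (\<lambda>z. f z - x n z)"
    using fatou[of 1] CX[of 1] by auto
  from sqint_add[OF this x(1)[of n]] have f: "sqint f"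
    by simp
  have "X \<longlonglongrightarrow> L2_of f"
  proof (rule LIMSEQ_I)
    fix e :: real assume "e > 0"
    then obtain N where "\<forall>i\<ge>N. \<forall>j\<ge>N. norm (X i - X j) < e/2"
      using CX[of "e/2"] by auto
    then have "norm (L2_of (\<lambda>z. f z - x n z)) \<le> e/2" if "n \<ge> N" for n
      using fatou[of "e/2" N n] that \<open>e > 0\<close> by auto
    then have "norm (L2_of f - X n) \<le> e/2" if "n \<ge> N" for n
      using that by (simp add: x L2_of_diff f)
    then show "\<exists>N. \<forall>n\<ge>N. norm (X n - L2_of f) < e"
      using \<open>e > 0\<close> by (intro exI[of _ N]) (force simp: norm_minus_commute)
  qed
  then show "convergent X"
    by (rule convergentI)
qed

section \<open>Fourier series\<close>

lemma AE_circle_norm: "AE z in circle_measure. norm z = 1"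
  by (rule AE_I2) simp

lemma sqint_bounded:
  assumes "f \<in> borel_measurable circle_measure" "\<And>z. norm z = 1 \<Longrightarrow> norm (f z) \<le> C"
  shows "sqint f"
proof -
  have "AE z in circle_measure. norm ((norm (f z))\<^sup>2) \<le> C\<^sup>2"
    using AE_circle_norm by eventually_elim (auto intro!: power_mono assms(2))
  then have "integrable circle_measure (\<lambda>z. (norm (f z))\<^sup>2)"
    using assms(1) by (intro circle_measure.integrable_const_bound) auto
  then show ?thesis
    using assms(1) by (simp add: sqint_def)
qed

lemma measure_circle [simp]: "measure circle_measure (sphere 0 1) = 1"
  using prob_circle by (simp add: measure_def)

lemma norm_L2_of_le:
  assumes "f \<in> borel_measurable circle_measure" "\<And>z. norm z = 1 \<Longrightarrow> norm (f z) \<le> C" "C \<ge> 0"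
  shows "norm (L2_of f) \<le> C"
proof -
  have f: "sqint f" by (rule sqint_bounded) (use assms in auto)
  have "(norm (L2_of f))\<^sup>2 \<le> (\<integral>z. C\<^sup>2 \<partial>circle_measure)"
    unfolding norm_L2_of[OF f]
    using f assms by (intro integral_mono) (auto simp: sqint_def intro!: power_mono)
  then show ?thesis
    using \<open>C \<ge> 0\<close> by (simp add: power2_le_iff_abs_le)
qed

lemma borel_measurable_circle_continuous:
  assumes "continuous_on (sphere 0 1) f" shows "f \<in> borel_measurable circle_measure"
  using borel_measurable_continuous_on_restrict[OF assms]
  by (simp cong: measurable_cong_sets add: sets_circle)

lemma powi_measurable [measurable]: "(\<lambda>z::complex. z powi n) \<in> borel_measurable circle_measure"
  by (intro borel_measurable_circle_continuous continuous_intros) auto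

definition zpow :: "int \<Rightarrow> L2" where
  "zpow n = L2_of (\<lambda>z. z powi n)"

lemma sqint_powi: "sqint (\<lambda>z. z powi n)"
  by (rule sqint_bounded[of _ 1]) (auto simp: norm_power_int)

lemma uniform_measure_density:
  "uniform_measure lborel {-pi..pi} = density lborel (\<lambda>x. ennreal (indicator {-pi..pi} x / (2*pi)))"
  unfolding uniform_measure_def
  by (rule density_cong) (auto simp: emeasure_lborel_Icc indicator_def divide_ennreal simp flip: ennreal_1 intro!: AE_I2)

lemma integral_circle_powi: "(\<integral>z. z powi n \<partial>circle_measure) = (if n = 0 then 1 else 0)"
proof -
  have cm: "(\<lambda>x. cis (of_int n * x)) \<in> borel_measurable borel"
    by (intro borel_measurable_continuous_onI continuous_intros)
  have m: "(\<lambda>z::complex. z powi n) \<in> borel_measurable (restrict_space borel (sphere 0 1))"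
    by (intro borel_measurable_continuous_on_restrict continuous_intros) auto
  have "(\<integral>z. z powi n \<partial>circle_measure) = (\<integral>x. cis x powi n \<partial>uniform_measure lborel {-pi..pi})"
    unfolding circle_measure_def by (rule integral_distr[OF cis_measurable_circle m])
  also have "\<dots> = (\<integral>x. cis (of_int n * x) \<partial>uniform_measure lborel {-pi..pi})"
    by (simp add: cis_power_int)
  also have "\<dots> = (\<integral>x. (indicator {-pi..pi} x / (2*pi)) *\<^sub>R cis (of_int n * x) \<partial>lborel)"
    unfolding uniform_measure_density using cm by (intro integral_density) auto
  also have "\<dots> = (1/(2*pi)) *\<^sub>R (\<integral>x. indicator {-pi..pi} x *\<^sub>R cis (of_int n * x) \<partial>lborel)"
    by (subst integral_scaleR_right[symmetric]) (simp add: scaleR_conv_of_real field_simps)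
  also have "\<dots> = (if n = 0 then 1 else 0)"
  proof (cases "n = 0")
    case True
    then show ?thesis by (simp add: scaleR_conv_of_real)
  next
    case False
    have "(\<integral>x. indicator {-pi..pi} x *\<^sub>R cis (of_int n * x) \<partial>lborel)
      = cis (of_int n * pi) / (\<i> * of_int n) - cis (of_int n * (-pi)) / (\<i> * of_int n)"
    proof (rule integral_FTC_Icc)
      fix x :: real
      have "((\<lambda>x. exp (\<i> * of_int n * x) / (\<i> * of_int n)) has_field_derivative exp (\<i> * of_int n * (of_real x)))
         (at (of_real x))"
        using False by (auto intro!: derivative_eq_intros)
      then have "((\<lambda>x. exp (\<i> * of_int n * of_real x) / (\<i> * of_int n)) has_vector_derivative exp (\<i> * of_int n * (of_real x)))
         (at x within {-pi..pi})"
        by (rule has_vector_derivative_real_field)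
      then show "((\<lambda>x. cis (of_int n * x) / (\<i> * of_int n)) has_vector_derivative cis (of_int n * x)) (at x within {-pi..pi})"
        by (simp add: cis_conv_exp mult.assoc)
    qed (auto intro!: continuous_intros)
    \<comment> \<open>The primitive takes the same value at both ends because the sine vanishes at
      integer multiples of pi.\<close>
    also have "cis (of_int n * (-pi)) = cis (of_int n * pi)"
      by (simp add: complex_eq_iff mult.commute sin_npi_int)
    finally show ?thesis using False by simp
  qed
  finally show ?thesis .
qed

lemma cnj_unit: "norm z = 1 \<Longrightarrow> cnj z = inverse z"
  by (rule sym, rule inverse_unique) (simp add: mult.commute flip: complex_norm_square)

lemma cinner_zpow_right:
  assumes "sqint f" shows "cinner (L2_of f) (zpow n) = (\<integral>z. f z * z powi (-n) \<partial>circle_measure)"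
  unfolding zpow_def cinner_L2_of[OF assms sqint_powi]
  by (rule Bochner_Integration.integral_cong) (auto simp: cnj_unit power_int_minus power_int_inverse)

lemma cinner_zpow_zpow: "cinner (zpow m) (zpow n) = (if m = n then 1 else 0)"
proof -
  have "cinner (zpow m) (zpow n) = (\<integral>z. z powi (m - n) \<partial>circle_measure)"
    unfolding zpow_def[of m] cinner_zpow_right[OF sqint_powi]
  proof (rule Bochner_Integration.integral_cong)
    fix z :: complex assume "z \<in> space circle_measure"
    then have "z \<noteq> 0" by auto
    then show "z powi m * z powi (- n) = z powi (m - n)"
      by (simp flip: power_int_add)
  qed simp
  then show ?thesis
    by (simp add: integral_circle_powi)
qed

lemma norm_zpow [simp]: "norm (zpow n) = 1"
proof -
  have "complex_of_real ((norm (zpow n))\<^sup>2) = 1"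
    using cinner_self[of "zpow n"] by (simp add: cinner_zpow_zpow)
  then have "(norm (zpow n))\<^sup>2 = 1\<^sup>2"
    by (metis of_real_eq_1_iff one_power2)
  then show ?thesis
    using norm_ge_zero[of "zpow n"] by (auto simp: power2_eq_1_iff simp del: norm_ge_zero)
qed

text \<open>
  A function orthogonal to all characters is orthogonal to all polynomials in the real and imaginary part,
  hence, by Stone-Weierstrass, to all continuous functions, hence to all indicators of closed sets.
\<close>

lemma AE_zero_if_Fourier_zero:
  assumes f: "sqint f" and zero: "\<And>n::int. (\<integral>z. f z * z powi n \<partial>circle_measure) = 0"
  shows "AE z in circle_measure. f z = 0"
proof -
  let ?M = circle_measure
  have [measurable]: "f \<in> borel_measurable ?M"
    using f by (simp add: sqint_def)
  have intf: "integrable ?M f"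
    using sqint_mult_integrable[OF f sqint_const[of 1]] by simp
  have intfg: "integrable ?M (\<lambda>z. f z * g z)"
    if "g \<in> borel_measurable ?M" "\<And>z. norm z = 1 \<Longrightarrow> norm (g z) \<le> C" for g C
    using sqint_mult_integrable[OF f sqint_cnj[OF sqint_bounded[OF that]]] by simp
  \<comment> \<open>Orthogonality is required against g times every power of z, not just against g:
    on the circle a real linear function is a combination of z and 1/z, so multiplying g by it only
    shifts n.\<close>
  define A where "A = {g. g \<in> borel_measurable ?M \<and> (\<exists>C. \<forall>z. norm z = 1 \<longrightarrow> norm (g z) \<le> C) \<and>
    (\<forall>n. (\<integral>z. f z * g z * z powi n \<partial>?M) = 0)}"
  have int3: "integrable ?M (\<lambda>z. f z * g z * z powi n)" if "g \<in> A" for g n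
  proof -
    from that obtain C where "g \<in> borel_measurable ?M" "\<forall>z. norm z = 1 \<longrightarrow> norm (g z) \<le> C"
      by (auto simp: A_def)
    then have "integrable ?M (\<lambda>z. f z * (g z * z powi n))"
      by (intro intfg[of _ C]) (auto simp: norm_mult norm_power_int)
    then show ?thesis by (simp add: mult.assoc)
  qed
  \<comment> \<open>Quantifying over all g in A inside the induction reduces the product case to two
    successive applications.\<close>
  have step: "\<forall>g\<in>A. (\<lambda>z. of_real (p z) * g z) \<in> A" if "real_polynomial_function p" for p :: "complex \<Rightarrow> real"
    using that
  proof induction
    case (linear p)
    show ?case
    proof
      fix g assume g: "g \<in> A"
      then obtain C where C: "g \<in> borel_measurable ?M" "\<forall>z. norm z = 1 \<longrightarrow> norm (g z) \<le> C"
        by (auto simp: A_def)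
      obtain K where K: "\<And>z. norm (p z) \<le> norm z * K"
        using bounded_linear.bounded[OF linear] by blast
      have "p \<in> borel_measurable borel"
        by (intro borel_measurable_continuous_onI linear_continuous_on linear)
      then have [measurable]: "p \<in> borel_measurable ?M"
        using measurable_compose[OF ident_measurable_circle] by blast
      \<comment> \<open>The coefficients come from Re z = (z + 1/z)/2 and Im z = (z - 1/z)/(2i),
        valid since \<open>cnj z\<close> is 1/z on the circle.\<close>
      define a where "a = Complex (p 1 / 2) (- p \<i> / 2)"
      define b where "b = Complex (p 1 / 2) (p \<i> / 2)"
      have p: "complex_of_real (p z) = a * z + b * inverse z" if "norm z = 1" for z
      proof -
        have "p z = p (Re z *\<^sub>R 1 + Im z *\<^sub>R \<i>)"
          by (rule arg_cong[of _ _ p]) (simp add: complex_eq_iff)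
        also have "\<dots> = Re z * p 1 + Im z * p \<i>"
          using linear by (simp add: bounded_linear.linear linear_add linear_scale)
        finally have "p z = Re z * p 1 + Im z * p \<i>" .
        then show ?thesis
          unfolding cnj_unit[OF that, symmetric] by (simp add: a_def b_def complex_eq_iff)
      qed
      have "(\<integral>z. f z * (of_real (p z) * g z) * z powi n \<partial>?M) = 0" for n
      proof -
        have "(\<integral>z. f z * (of_real (p z) * g z) * z powi n \<partial>?M)
          = (\<integral>z. a * (f z * g z * z powi (n + 1)) + b * (f z * g z * z powi (n - 1)) \<partial>?M)"
        proof (rule Bochner_Integration.integral_cong)
          fix z :: complex assume "z \<in> space ?M"
          then have z: "norm z = 1" "z \<noteq> 0" by auto
          then show "f z * (of_real (p z) * g z) * z powi n
            = a * (f z * g z * z powi (n + 1)) + b * (f z * g z * z powi (n - 1))"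
            by (simp add: p power_int_add power_int_diff field_simps)
        qed simp
        also have "\<dots> = a * (\<integral>z. f z * g z * z powi (n + 1) \<partial>?M) + b * (\<integral>z. f z * g z * z powi (n - 1) \<partial>?M)"
          using int3[OF g] by simp
        also have "\<dots> = 0" using g by (simp add: A_def)
        finally show ?thesis .
      qed
      moreover have "norm (of_real (p z) * g z) \<le> K * C" if "norm z = 1" for z
        using K[of z] C(2) that by (auto simp: norm_mult intro!: mult_mono intro: order.trans[OF norm_ge_zero])
      moreover have "(\<lambda>z. of_real (p z) * g z) \<in> borel_measurable ?M"
        using C(1) by simp
      ultimately show "(\<lambda>z. of_real (p z) * g z) \<in> A"
        unfolding A_def by blast
    qed
  next
    case (const c)
    show ?case
    proof
      fix g assume g: "g \<in> A"
      then obtain C where C: "g \<in> borel_measurable ?M" "\<forall>z. norm z = 1 \<longrightarrow> norm (g z) \<le> C"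
        by (auto simp: A_def)
      have "(\<integral>z. f z * (of_real c * g z) * z powi n \<partial>?M) = of_real c * (\<integral>z. f z * g z * z powi n \<partial>?M)" for n
        by (subst integral_mult_right_zero[symmetric]) (simp add: ac_simps)
      moreover have "norm (of_real c * g z) \<le> \<bar>c\<bar> * C" if "norm z = 1" for z
        using C(2) that by (simp add: norm_mult mult_left_mono)
      ultimately show "(\<lambda>z. of_real c * g z) \<in> A"
        using g C unfolding A_def by auto
    qed
  next
    case (add p q)
    show ?case
    proof
      fix g assume "g \<in> A"
      then have pq: "(\<lambda>z. of_real (p z) * g z) \<in> A" "(\<lambda>z. of_real (q z) * g z) \<in> A"
        using add by auto
      then obtain C D where C: "\<forall>z. norm z = 1 \<longrightarrow> norm (of_real (p z) * g z) \<le> C"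
        "\<forall>z. norm z = 1 \<longrightarrow> norm (of_real (q z) * g z) \<le> D"
        unfolding A_def by blast
      have eq: "of_real (p z + q z) * g z = of_real (p z) * g z + of_real (q z) * g z" for z
        by (simp add: algebra_simps)
      have "norm (of_real (p z + q z) * g z) \<le> C + D" if "norm z = 1" for z
        unfolding eq using C that by (intro norm_triangle_mono) auto
      moreover have "(\<integral>z. f z * (of_real (p z + q z) * g z) * z powi n \<partial>?M) = 0" for n
        using int3[OF pq(1), of n] int3[OF pq(2), of n] pq unfolding A_def
        by (simp add: eq distrib_left distrib_right)
      moreover have "(\<lambda>z. of_real (p z + q z) * g z) \<in> borel_measurable ?M"
        unfolding eq using pq by (auto simp: A_def)
      ultimately show "(\<lambda>z. of_real (p z + q z) * g z) \<in> A"
        unfolding A_def by blast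
    qed
  next
    case (mult p q)
    then show ?case by (simp add: mult.assoc)
  qed
  have "(\<lambda>_. 1) \<in> A"
    using zero by (auto simp: A_def intro: exI[of _ 1])
  then have poly: "(\<integral>z. f z * of_real (p z) \<partial>?M) = 0" if "real_polynomial_function p" for p
  proof -
    have "(\<lambda>z. of_real (p z) * 1) \<in> A"
      using bspec[OF step[OF that] \<open>(\<lambda>_. 1) \<in> A\<close>] .
    then have "(\<integral>z. f z * (of_real (p z) * 1) * z powi 0 \<partial>?M) = 0"
      unfolding A_def by blast
    then show ?thesis by simp
  qed
  have polym: "p \<in> borel_measurable ?M" if "real_polynomial_function p" for p
    using that by (intro borel_measurable_circle_continuous continuous_on_subset[OF continuous_on_polymonial_function])
      (auto simp: real_polynomial_function_eq)
  have cont: "(\<integral>z. f z * of_real (h z) \<partial>?M) = 0" if h: "continuous_on (sphere 0 1) h" for h :: "complex \<Rightarrow> real"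
  proof -
    have [measurable]: "h \<in> borel_measurable ?M"
      by (rule borel_measurable_circle_continuous[OF h])
    have "norm (\<integral>z. f z * of_real (h z) \<partial>?M) \<le> e * (\<integral>z. norm (f z) \<partial>?M)" if "e > 0" for e
    proof -
      obtain p where p: "real_polynomial_function p" "\<And>z. z \<in> sphere 0 1 \<Longrightarrow> \<bar>h z - p z\<bar> < e"
        using Stone_Weierstrass_real_polynomial_function[OF compact_sphere h \<open>e > 0\<close>] by blast
      note [measurable] = polym[OF p(1)]
      obtain B where B: "\<And>z. norm z = 1 \<Longrightarrow> norm (h z) \<le> B"
        using compact_imp_bounded[OF compact_continuous_image[OF h compact_sphere]]
        by (force simp: bounded_iff)
      have Bp: "norm (p z) \<le> B + e" if "norm z = 1" for z
        using B[OF that] p(2)[of z] that by auto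
      have i1: "integrable ?M (\<lambda>z. f z * of_real (h z))" "integrable ?M (\<lambda>z. f z * of_real (p z))"
        using B Bp by (auto intro!: intfg)
      have "(\<integral>z. f z * of_real (h z) \<partial>?M) = (\<integral>z. f z * of_real (h z) - f z * of_real (p z) \<partial>?M)"
        using poly[OF p(1)] i1 by simp
      also have "norm \<dots> \<le> (\<integral>z. norm (f z * of_real (h z) - f z * of_real (p z)) \<partial>?M)"
        by (rule integral_norm_bound)
      also have "\<dots> \<le> (\<integral>z. e * norm (f z) \<partial>?M)"
      proof (rule integral_mono)
        fix z assume "z \<in> space ?M"
        then have "\<bar>h z - p z\<bar> \<le> e" using p(2)[of z] by auto
        moreover have "f z * of_real (h z) - f z * of_real (p z) = f z * of_real (h z - p z)"
          by (simp add: algebra_simps)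
        ultimately show "norm (f z * of_real (h z) - f z * of_real (p z)) \<le> e * norm (f z)"
          using mult_right_mono[of "\<bar>h z - p z\<bar>" e "norm (f z)"] by (simp only: norm_mult norm_of_real) (simp add: mult.commute)
      qed (use i1 intf in auto)
      finally show ?thesis by simp
    qed
    note le = this
    show ?thesis
    proof (rule ccontr)
      assume "(\<integral>z. f z * of_real (h z) \<partial>?M) \<noteq> 0"
      then have pos: "norm (\<integral>z. f z * of_real (h z) \<partial>?M) > 0" (is "?a > 0") by simp
      define I where "I = (\<integral>z. norm (f z) \<partial>?M)"
      have I: "I \<ge> 0" unfolding I_def by simp
      \<comment> \<open>This choice of e stays positive without knowing I > 0, and turns the
        estimate into ?a \<le> ?a/2.\<close>
      have "?a / (2 * (I + 1)) > 0"
        using pos I by (intro divide_pos_pos) auto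
      from le[OF this] have "?a \<le> (?a / (2 * (I + 1))) * I"
        by (simp only: I_def)
      also have "\<dots> = (?a / 2) * (I / (I + 1))" by (simp add: field_simps)
      also have "\<dots> \<le> (?a / 2) * 1"
        using pos I by (intro mult_left_mono) auto
      finally show False using pos by simp
    qed
  qed
  have closed: "set_lebesgue_integral ?M (K \<inter> sphere 0 1) f = 0" if K: "closed K" for K
  proof (cases "K = {}")
    case False
    \<comment> \<open>Continuous cut-offs that decrease to the indicator of K and never exceed 1, so
      that \<open>norm (f z)\<close> dominates. The empty set is treated apart because
      \<open>infdist\<close> to it is 0 by convention, which would make every \<open>h k\<close>
      equal to 1.\<close>
    define h where "h k z = max 0 (1 - real k * infdist z K)" for k z
    have hc: "continuous_on (sphere 0 1) (h k)" for k
      unfolding h_def by (intro continuous_intros)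
    have [measurable]: "h k \<in> borel_measurable ?M" for k
      by (rule borel_measurable_circle_continuous[OF hc])
    have [measurable]: "K \<inter> sphere 0 1 \<in> sets ?M"
      using K by (auto simp: sets_circle sets_restrict_space)
    have "(\<lambda>k. \<integral>z. f z * of_real (h k z) \<partial>?M) \<longlonglongrightarrow> (\<integral>z. indicator (K \<inter> sphere 0 1) z *\<^sub>R f z \<partial>?M)"
    proof (rule integral_dominated_convergence[where w = "\<lambda>z. norm (f z)"])
      show "AE z in ?M. (\<lambda>k. f z * of_real (h k z)) \<longlonglongrightarrow> indicator (K \<inter> sphere 0 1) z *\<^sub>R f z"
        using AE_circle_norm
      proof eventually_elim
        case (elim z)
        have "(\<lambda>k. h k z) \<longlonglongrightarrow> indicator K z"
        proof (cases "z \<in> K")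
          case True
          then show ?thesis by (simp add: h_def)
        next
          case zK: False
          then have pos: "infdist z K > 0"
            using infdist_pos_not_in_closed[OF K False] by blast
          obtain N where "real N * infdist z K > 1"
            using reals_Archimedean3[OF pos] by blast
          moreover have "real N * infdist z K \<le> real k * infdist z K" if "k \<ge> N" for k
            using that pos by (intro mult_right_mono) auto
          ultimately have "h k z = 0" if "k \<ge> N" for k
            using that unfolding h_def by (intro max_absorb1) (smt (verit))
          then have "\<forall>\<^sub>F k in sequentially. h k z = 0"
            by (auto intro: eventually_sequentiallyI)
          then show ?thesis
            using zK by (simp add: tendsto_eventually)
        qed
        then have "(\<lambda>k. f z * of_real (h k z)) \<longlonglongrightarrow> f z * of_real (indicator K z)"
          by (intro tendsto_intros)
        then show ?case
          using elim by (cases "z \<in> K") simp_all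
      qed
      show "AE z in ?M. norm (f z * of_real (h k z)) \<le> norm (f z)" for k
      proof (rule AE_I2)
        fix z
        have "\<bar>h k z\<bar> \<le> 1"
          by (auto simp: h_def infdist_nonneg)
        then show "norm (f z * of_real (h k z)) \<le> norm (f z)"
          by (simp add: norm_mult mult_left_le)
      qed
    qed (use intf in auto)
    then show ?thesis
      by (simp add: cont[OF hc] set_lebesgue_integral_def LIMSEQ_const_iff)
  qed (simp add: set_lebesgue_integral_def)
  have msets: "B \<inter> sphere 0 1 \<in> sets ?M" if "B \<in> sets borel" for B
    using that by (auto simp: sets_circle sets_restrict_space)
  have si: "set_integrable ?M S f" if "S \<in> sets ?M" for S
    unfolding set_integrable_def using that intf by (rule integrable_mult_indicator)
  have borel: "set_lebesgue_integral ?M (B \<inter> sphere 0 1) f = 0" if "B \<in> sets borel" for B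
  proof -
    have eq: "sets borel = sigma_sets UNIV {S::complex set. closed S}"
      unfolding borel_eq_closed by simp
    have "Int_stable {S::complex set. closed S}" "{S::complex set. closed S} \<subseteq> Pow UNIV"
      by (auto simp: Int_stable_def)
    moreover have "B \<in> sigma_sets UNIV {S. closed S}"
      using that eq by simp
    ultimately show ?thesis
    proof (induction rule: sigma_sets_induct_disjoint)
      case (basic S)
      then show ?case using closed by simp
    next
      case empty
      then show ?case by (simp add: set_lebesgue_integral_def)
    next
      case (compl S)
      have "S \<in> sets borel" "UNIV - S \<in> sets borel" using compl(1) eq by (auto intro: sigma_sets.Compl)
      then have "set_lebesgue_integral ?M ((S \<inter> sphere 0 1) \<union> ((UNIV - S) \<inter> sphere 0 1)) f
        = set_lebesgue_integral ?M (S \<inter> sphere 0 1) f + set_lebesgue_integral ?M ((UNIV - S) \<inter> sphere 0 1) f"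
        by (intro set_integral_Un si msets) auto
      \<comment> \<open>The two pieces make up the whole circle, on which the integral vanishes
        because \<open>UNIV\<close> is closed.\<close>
      moreover have "(S \<inter> sphere 0 1) \<union> ((UNIV - S) \<inter> sphere 0 1) = UNIV \<inter> sphere 0 1" by auto
      ultimately show ?case
        using compl(2) closed[OF closed_UNIV] by simp
    next
      case (union S)
      have "\<And>i. S i \<in> sets borel" using union(2) eq by auto
      then have m: "\<And>i. S i \<inter> sphere 0 1 \<in> sets ?M" by (rule msets)
      have "set_lebesgue_integral ?M (\<Union>i. S i \<inter> sphere 0 1) f = (\<Sum>i. set_lebesgue_integral ?M (S i \<inter> sphere 0 1) f)"
        using union(1)
        by (intro lebesgue_integral_countable_add[OF m _ si] sets.countable_UN) (auto simp: disjoint_family_on_def m)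
      then show ?case
        using union(3) by (simp add: Int_UN_distrib2)
    qed
  qed
  show ?thesis
  proof (rule circle_measure.density_zero[OF intf])
    fix S assume "S \<in> sets ?M"
    then obtain B where "B \<in> sets borel" "S = B \<inter> sphere 0 1"
      by (auto simp: sets_circle sets_restrict_space)
    then show "set_lebesgue_integral ?M S f = 0"
      using borel by simp
  qed
qed

lemma L2_eqI:
  assumes "\<And>n. cinner f (zpow n) = cinner g (zpow n)" shows "f = g"
proof -
  obtain h where h: "sqint h" "f - g = L2_of h" by (rule L2_exhaust)
  have "(\<integral>z. h z * z powi n \<partial>circle_measure) = 0" for n
    using cinner_zpow_right[OF h(1), of "-n"] assms by (simp add: cinner_diff_left flip: h(2))
  from AE_zero_if_Fourier_zero[OF h(1) this] have "L2_of h = L2_of (\<lambda>_. 0)"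
    by (subst L2_of_eq_iff) (simp_all add: h sqint_const)
  also have "\<dots> = 0"
    by transfer (auto simp: L2_rel_def sqint_const)
  finally show ?thesis
    using h(2) by simp
qed

section \<open>Bessel's inequality and one-sided Fourier series\<close>

lemma cscale_add_left: "cscale (a + b) f = cscale a f + cscale b f"
  by transfer (auto simp: L2_rel_def distrib_right intro!: sqint_add sqint_cscale)

text \<open>Pythagoras for orthonormal characters. The injection \<open>\<nu>\<close> lets a sum run
  over natural numbers while the characters are indexed by integers.\<close>

lemma norm_sum_zpow:
  assumes "finite S" "inj_on \<nu> S"
  shows "(norm (\<Sum>k\<in>S. cscale (c k) (zpow (\<nu> k))))\<^sup>2 = (\<Sum>k\<in>S. (cmod (c k))\<^sup>2)"
  using assms
proof (induction S)
  case (insert j S)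
  have "cinner (\<Sum>k\<in>S. cscale (c k) (zpow (\<nu> k))) (zpow (\<nu> j)) = (\<Sum>k\<in>S. c k * cinner (zpow (\<nu> k)) (zpow (\<nu> j)))"
    by (simp add: linear_sum[OF bounded_linear.linear[OF bounded_linear_cinner_left]] cinner_cscale_left)
  also have "\<dots> = 0"
    using insert by (intro sum.neutral ballI) (auto simp: cinner_zpow_zpow inj_on_def)
  finally have "inner (cscale (c j) (zpow (\<nu> j))) (\<Sum>k\<in>S. cscale (c k) (zpow (\<nu> k))) = 0"
    unfolding inner_L2_def cinner_cscale_left by (subst cinner_commute) simp
  then show ?case
    using insert by (simp add: power2_norm_eq_inner inner_add_left inner_add_right inner_commute)
      (simp flip: power2_norm_eq_inner)
qed simp

text \<open>For the partial Fourier sum g both \<open>inner f g\<close> and the squared norm of g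
  equal the left-hand side, so the claim is the expansion of the squared norm of f - g, which is
  nonnegative.\<close>

lemma Bessel:
  assumes "finite S" "inj_on \<nu> S"
  shows "(\<Sum>k\<in>S. (cmod (cinner f (zpow (\<nu> k))))\<^sup>2) \<le> (norm f)\<^sup>2"
proof -
  define g where "g = (\<Sum>k\<in>S. cscale (cinner f (zpow (\<nu> k))) (zpow (\<nu> k)))"
  have "cinner f g = (\<Sum>k\<in>S. complex_of_real ((cmod (cinner f (zpow (\<nu> k))))\<^sup>2))"
    unfolding g_def linear_sum[OF bounded_linear.linear[OF bounded_linear_cinner_right]]
    by (simp add: cinner_cscale_right complex_norm_square mult.commute del: of_real_power)
  then have "inner f g = (\<Sum>k\<in>S. (cmod (cinner f (zpow (\<nu> k))))\<^sup>2)"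
    by (simp add: inner_L2_def)
  moreover have "(norm g)\<^sup>2 = (\<Sum>k\<in>S. (cmod (cinner f (zpow (\<nu> k))))\<^sup>2)"
    unfolding g_def by (rule norm_sum_zpow[OF assms])
  moreover have "0 \<le> (norm (f - g))\<^sup>2" by simp
  ultimately show ?thesis
    by (simp add: power2_norm_eq_inner inner_diff_left inner_diff_right inner_commute)
qed

lemma summable_Fourier: "summable (\<lambda>k. (cmod (cinner f (zpow (int k))))\<^sup>2)"
  by (rule summableI_nonneg_bounded[where x = "(norm f)\<^sup>2"]) (auto intro!: Bessel inj_onI)

text \<open>The powers of r describe the dilates of a power series. Uniformity up to and including r
  = 1 makes the limit continuous there, which is how boundary values in quadratic mean arise. Tails
  are controlled by orthonormality, as \<open>r ^ k\<close> is at most 1.\<close>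

lemma uniformly_convergent_zpow_series:
  assumes "summable (\<lambda>k. (cmod (c k))\<^sup>2)"
  shows "uniformly_convergent_on {0..1::real} (\<lambda>N r. \<Sum>k<N. cscale (c k * of_real r ^ k) (zpow (int k)))"
proof (rule Cauchy_uniformly_convergent, rule uniformly_Cauchy_onI')
  fix e :: real assume "e > 0"
  then obtain N where N: "\<And>m n. m \<ge> N \<Longrightarrow> norm (sum (\<lambda>k. (cmod (c k))\<^sup>2) {m..<n}) < e\<^sup>2"
    using assms unfolding summable_Cauchy by (meson zero_less_power)
  have "dist (\<Sum>k<m. cscale (c k * of_real r ^ k) (zpow (int k))) (\<Sum>k<n. cscale (c k * of_real r ^ k) (zpow (int k))) < e"
    if r: "r \<in> {0..1}" and mn: "m \<ge> N" "n > m" for r m n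
  proof -
    have "{..<n} - {..<m} = {m..<n}" by auto
    then have "(\<Sum>k<n. cscale (c k * of_real r ^ k) (zpow (int k))) - (\<Sum>k<m. cscale (c k * of_real r ^ k) (zpow (int k)))
      = (\<Sum>k=m..<n. cscale (c k * of_real r ^ k) (zpow (int k)))"
      using sum_diff[of "{..<n}" "{..<m}" "\<lambda>k. cscale (c k * of_real r ^ k) (zpow (int k))"] mn by auto
    then have "dist (\<Sum>k<m. cscale (c k * of_real r ^ k) (zpow (int k))) (\<Sum>k<n. cscale (c k * of_real r ^ k) (zpow (int k)))
      = norm (\<Sum>k=m..<n. cscale (c k * of_real r ^ k) (zpow (int k)))"
      by (subst dist_commute) (simp only: dist_norm)
    then have "(dist (\<Sum>k<m. cscale (c k * of_real r ^ k) (zpow (int k))) (\<Sum>k<n. cscale (c k * of_real r ^ k) (zpow (int k))))\<^sup>2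
      = (\<Sum>k=m..<n. (cmod (c k * of_real r ^ k))\<^sup>2)"
      by (simp only:) (rule norm_sum_zpow, auto simp: inj_on_def)
    also have "\<dots> \<le> (\<Sum>k=m..<n. (cmod (c k))\<^sup>2)"
      using r by (intro sum_mono power_mono) (auto simp: norm_mult norm_power mult_left_le power_le_one)
    also have "\<dots> < e\<^sup>2"
      using N[OF mn(1), of n] by simp
    finally show ?thesis
      using \<open>e > 0\<close> by (simp add: power2_less_imp_less)
  qed
  then show "\<exists>M. \<forall>x\<in>{0..1}. \<forall>m\<ge>M. \<forall>n>m. dist (\<Sum>k<m. cscale (c k * of_real x ^ k) (zpow (int k)))
      (\<Sum>k<n. cscale (c k * of_real x ^ k) (zpow (int k))) < e"
    by blast
qed

lemma summable_zpow_series: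
  assumes "summable (\<lambda>k. (cmod (c k))\<^sup>2)" shows "summable (\<lambda>k. cscale (c k) (zpow (int k)))"
proof -
  have "convergent (\<lambda>N. \<Sum>k<N. cscale (c k * of_real 1 ^ k) (zpow (int k)))"
    by (rule uniformly_convergent_imp_convergent[OF uniformly_convergent_zpow_series[OF assms]]) simp
  then show ?thesis
    by (simp add: summable_iff_convergent)
qed

lemma cinner_zpow_series:
  assumes "(\<lambda>k. cscale (c k) (zpow (int k))) sums f"
  shows "cinner f (zpow n) = (if n \<ge> 0 then c (nat n) else 0)"
proof -
  have "(\<lambda>k. cinner (cscale (c k) (zpow (int k))) (zpow n)) sums cinner f (zpow n)"
    by (rule bounded_linear.sums[OF bounded_linear_cinner_left assms])
  moreover have "(\<lambda>k. cinner (cscale (c k) (zpow (int k))) (zpow n)) sums (if n \<ge> 0 then c (nat n) else 0)"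
  proof (cases "n \<ge> 0")
    case True
    then obtain m where "n = int m" using nonneg_int_cases by blast
    then show ?thesis
      using sums_single[of m c] by (simp add: cinner_cscale_left cinner_zpow_zpow if_distrib cong: if_cong)
  next
    case False
    then have "cinner (cscale (c k) (zpow (int k))) (zpow n) = 0" for k
      by (auto simp: cinner_cscale_left cinner_zpow_zpow)
    with False show ?thesis by simp
  qed
  ultimately show ?thesis
    by (rule sums_unique2)
qed

text \<open>The projection P, written through Fourier coefficients so that its existence is a matter
  of convergence; \<open>orth_proj_H2\<close> identifies it with
  \<open>orth_proj H2\<close>.\<close>

definition Riesz_proj :: "L2 \<Rightarrow> L2" where
  "Riesz_proj f = (\<Sum>k. cscale (cinner f (zpow (int k))) (zpow (int k)))"

lemma sums_Riesz_proj: "(\<lambda>k. cscale (cinner f (zpow (int k))) (zpow (int k))) sums Riesz_proj f"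
  unfolding Riesz_proj_def by (intro summable_sums summable_zpow_series summable_Fourier)

lemma cinner_Riesz_proj: "cinner (Riesz_proj f) (zpow n) = (if n \<ge> 0 then cinner f (zpow n) else 0)"
  using cinner_zpow_series[OF sums_Riesz_proj[of f]] by simp

lemma zpow_series_eq:
  assumes "\<And>n. n < 0 \<Longrightarrow> cinner f (zpow n) = 0"
  shows "(\<lambda>k. cscale (cinner f (zpow (int k))) (zpow (int k))) sums f"
proof -
  have "Riesz_proj f = f"
    by (rule L2_eqI) (simp add: cinner_Riesz_proj assms)
  then show ?thesis using sums_Riesz_proj[of f] by simp
qed

section \<open>Hardy space\<close>

lemma L2_of_sum_powi:
  "L2_of (\<lambda>z. \<Sum>k<N. c k * z ^ k) = (\<Sum>k<N. cscale (c k) (zpow (int k)))"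
proof -
  have sq: "sqint (\<lambda>z. \<Sum>k<N. c k * z powi int k)" for N
    by (induction N) (simp_all add: sqint_const sqint_add sqint_cscale sqint_powi del: power_int_of_nat)
  have "L2_of (\<lambda>z. \<Sum>k<N. c k * z powi int k) = (\<Sum>k<N. cscale (c k) (zpow (int k)))"
  proof (induction N)
    case 0
    show ?case by simp (transfer, auto simp: L2_rel_def sqint_const)
  next
    case (Suc N)
    then show ?case
      using sq[of N] by (simp add: L2_of_add sqint_cscale sqint_powi L2_of_cscale zpow_def del: power_int_of_nat)
  qed
  then show ?thesis by simp
qed

text \<open>Absolutely summable coefficients give uniform convergence on the circle, hence
  convergence in L2. It is applied to the dilates with r < 1, where the Taylor series converges
  absolutely.\<close>

lemma L2_of_power_series:
  assumes c: "summable (\<lambda>k. cmod (c k))" and F: "\<And>z. norm z = 1 \<Longrightarrow> (\<lambda>k. c k * z ^ k) sums F z"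
    and m: "F \<in> borel_measurable circle_measure"
  shows "(\<lambda>k. cscale (c k) (zpow (int k))) sums L2_of F"
  unfolding sums_def
proof (rule LIMSEQ_I)
  fix e :: real assume "e > 0"
  have sF: "summable (\<lambda>k. c k * z ^ k)" "F z = (\<Sum>k. c k * z ^ k)" "summable (\<lambda>k. norm (c k * z ^ k))" if "norm z = 1" for z
    using F[OF that] c that by (auto simp: sums_iff norm_mult norm_power)
  obtain N where N: "\<And>n. n \<ge> N \<Longrightarrow> norm (\<Sum>i. cmod (c (i + n))) < e"
    using suminf_exist_split[OF \<open>e > 0\<close> c] by blast
  have "norm ((\<Sum>k<n. cscale (c k) (zpow (int k))) - L2_of F) < e" if "n \<ge> N" for n
  proof -
    let ?T = "\<Sum>i. cmod (c (i + n))"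
    have T: "?T \<ge> 0" "?T < e"
      using N[OF that] by (auto intro!: suminf_nonneg summable_ignore_initial_segment c)
    have sF': "sqint F"
    proof (rule sqint_bounded[OF m])
      fix z :: complex assume z: "norm z = 1"
      then show "norm (F z) \<le> (\<Sum>k. cmod (c k))"
        using summable_norm[OF sF(3)[OF z]] by (simp add: sF(2)[OF z] norm_mult norm_power)
    qed
    have pm: "(\<lambda>z::complex. \<Sum>k<n. c k * z ^ k) \<in> borel_measurable circle_measure"
      by (intro borel_measurable_circle_continuous continuous_intros)
    have sp: "sqint (\<lambda>z. \<Sum>k<n. c k * z ^ k)"
    proof (rule sqint_bounded[OF pm])
      show "norm (\<Sum>k<n. c k * z ^ k) \<le> (\<Sum>k<n. cmod (c k))" if "norm z = 1" for z
        using norm_sum[of "\<lambda>k. c k * z ^ k" "{..<n}"] that by (simp add: norm_mult norm_power)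
    qed
    have "norm (L2_of (\<lambda>z. (\<Sum>k<n. c k * z ^ k) - F z)) \<le> ?T"
    proof (rule norm_L2_of_le)
      fix z :: complex assume z: "norm z = 1"
      have "F z - (\<Sum>k<n. c k * z ^ k) = (\<Sum>k. c (k + n) * z ^ (k + n))"
        using suminf_minus_initial_segment[OF sF(1)[OF z], of n] by (simp add: sF(2)[OF z])
      then have "norm ((\<Sum>k<n. c k * z ^ k) - F z) = norm (\<Sum>k. c (k + n) * z ^ (k + n))"
        by (metis norm_minus_commute)
      also have "\<dots> \<le> (\<Sum>k. norm (c (k + n) * z ^ (k + n)))"
        using sF(3)[OF z] by (intro summable_norm) (subst summable_iff_shift[where f = "\<lambda>k. norm (c k * z ^ k)"])
      also have "\<dots> = ?T"
        using z by (simp add: norm_mult norm_power)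
      finally show "norm ((\<Sum>k<n. c k * z ^ k) - F z) \<le> ?T" .
    qed (use m pm T in auto)
    then show ?thesis
      using T(2) by (simp add: L2_of_diff sp sF' L2_of_sum_powi)
  qed
  then show "\<exists>N. \<forall>n\<ge>N. norm ((\<Sum>k<n. cscale (c k) (zpow (int k))) - L2_of F) < e" by blast
qed

lemma continuous_dilate:
  assumes "F holomorphic_on ball 0 1" "0 \<le> r" "r < 1"
  shows "continuous_on (sphere 0 1) (\<lambda>z. F (of_real r * z))"
proof -
  have "continuous_on (ball 0 1) F"
    using assms(1) by (rule holomorphic_on_imp_continuous_on)
  then show ?thesis
    by (rule continuous_on_compose2) (use assms(2,3) in \<open>auto intro!: continuous_intros simp: norm_mult\<close>)
qed

text \<open>A dilate has a Taylor series without negative frequencies, and this passes to the limit.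
  Conversely, the coefficients of f are bounded, so they define a function F on the disc, and the
  dilates of F form a curve in L2 that is continuous up to r = 1 and ends at f.\<close>

lemma H2_iff: "f \<in> H2 \<longleftrightarrow> (\<forall>n<0. cinner f (zpow n) = 0)"
proof
  assume "f \<in> H2"
  then obtain F where F: "F holomorphic_on ball 0 1" and lim: "((\<lambda>r. L2_of (\<lambda>z. F (of_real r * z))) \<longlongrightarrow> f) (at_left (1::real))"
    by (auto simp: H2_def hardy_disc_def)
  show "\<forall>n<0. cinner f (zpow n) = 0"
  proof (intro allI impI)
    fix n :: int assume n: "n < 0"
    have "cinner (L2_of (\<lambda>z. F (of_real r * z))) (zpow n) = 0" if r: "0 < r" "r < 1" for r
    proof -
      define a where "a k = (deriv ^^ k) F 0 / fact k" for k
      have a: "(\<lambda>k. a k * w ^ k) sums F w" if "norm w < 1" for w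
        using holomorphic_power_series[OF F, of w] that by (simp add: a_def)
      \<comment> \<open>Absolute convergence at r is deduced from mere convergence at a point
        strictly further out.\<close>
      obtain s where s: "r < s" "s < 1" using dense r(2) by blast
      have "summable (\<lambda>k. norm (a k * of_real r ^ k))"
        using r s by (intro powser_insidea[of a "of_real s"] sums_summable[OF a]) auto
      then have "(\<lambda>k. cscale (a k * of_real r ^ k) (zpow (int k))) sums L2_of (\<lambda>z. F (of_real r * z))"
      proof (rule L2_of_power_series)
        show "(\<lambda>k. a k * of_real r ^ k * z ^ k) sums F (of_real r * z)" if "norm z = 1" for z
          using a[of "of_real r * z"] r that by (simp add: norm_mult power_mult_distrib mult.assoc)
        show "(\<lambda>z. F (of_real r * z)) \<in> borel_measurable circle_measure"
          using r by (intro borel_measurable_circle_continuous continuous_dilate F) auto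
      qed
      from cinner_zpow_series[OF this] n show ?thesis by simp
    qed
    then have "\<forall>\<^sub>F r in at_left (1::real). cinner (L2_of (\<lambda>z. F (of_real r * z))) (zpow n) = 0"
      using eventually_at_left_real[of 0 "1::real"] by (auto elim!: eventually_mono)
    then have "((\<lambda>r. cinner (L2_of (\<lambda>z. F (of_real r * z))) (zpow n)) \<longlongrightarrow> 0) (at_left (1::real))"
      by (rule tendsto_eventually)
    moreover have "((\<lambda>r. cinner (L2_of (\<lambda>z. F (of_real r * z))) (zpow n)) \<longlongrightarrow> cinner f (zpow n)) (at_left (1::real))"
      by (rule tendsto_cinner_left[OF lim])
    ultimately show "cinner f (zpow n) = 0"
      using tendsto_unique trivial_limit_at_left_real by blast
  qed
next
  assume neg: "\<forall>n<0. cinner f (zpow n) = 0"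
  define a where "a k = cinner f (zpow (int k))" for k
  have sq: "summable (\<lambda>k. (cmod (a k))\<^sup>2)"
    unfolding a_def by (rule summable_Fourier)
  have f: "(\<lambda>k. cscale (a k) (zpow (int k))) sums f"
    unfolding a_def using neg by (intro zpow_series_eq) auto
  have abd: "norm (a k) \<le> norm f" for k
    using norm_cinner_le[of f "zpow (int k)"] by (simp add: a_def)
  have abs: "summable (\<lambda>k. norm (a k * w ^ k))" if "norm w < 1" for w
  proof (rule summable_comparison_test)
    show "summable (\<lambda>k. norm f * norm w ^ k)"
      using that by (intro summable_mult summable_geometric) auto
    show "\<exists>N. \<forall>n\<ge>N. norm (norm (a n * w ^ n)) \<le> norm f * norm w ^ n"
      using abd by (auto simp: norm_mult norm_power intro!: mult_right_mono)
  qed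
  define F where "F w = (\<Sum>k. a k * w ^ k)" for w
  have Fs: "(\<lambda>k. a k * w ^ k) sums F w" if "norm w < 1" for w
    unfolding F_def by (rule summable_sums[OF summable_norm_cancel[OF abs[OF that]]])
  have hol: "F holomorphic_on ball 0 1"
    using Fs by (intro power_series_holomorphic[where a = a]) auto
  \<comment> \<open>G r will be the class of the dilate of F for r < 1, and G 1 will be f.\<close>
  obtain G where G: "uniform_limit {0..1::real} (\<lambda>N r. \<Sum>k<N. cscale (a k * of_real r ^ k) (zpow (int k))) G sequentially"
    using uniformly_convergent_zpow_series[OF sq] by (auto simp: uniformly_convergent_on_def)
  have contG: "continuous_on {0..1} G"
  proof (rule uniform_limit_theorem[OF _ G])
    have "continuous_on {0..1} (\<lambda>r::real. cscale (a k * of_real r ^ k) (zpow (int k)))" for k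
    proof -
      have "bounded_linear (\<lambda>c. cscale c (zpow (int k)))"
        by (rule bounded_linear_intro[of _ 1])
          (auto simp: cscale_add_left scaleR_L2_def scaleR_conv_of_real)
      then show ?thesis
        by (rule bounded_linear.continuous_on) (intro continuous_intros)
    qed
    then show "\<forall>\<^sub>F N in sequentially. continuous_on {0..1} (\<lambda>r::real. \<Sum>k<N. cscale (a k * of_real r ^ k) (zpow (int k)))"
      by (intro always_eventually allI continuous_on_sum) auto
  qed simp
  have Gs: "(\<lambda>k. cscale (a k * of_real r ^ k) (zpow (int k))) sums G r" if "r \<in> {0..1}" for r
    unfolding sums_def by (rule tendsto_uniform_limitI[OF G that])
  have G1: "G 1 = f"
    using Gs[of 1] sums_unique2[OF f] by simp
  have Gr: "G r = L2_of (\<lambda>z. F (of_real r * z))" if r: "0 \<le> r" "r < 1" for r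
  proof -
    have "summable (\<lambda>k. norm (a k * of_real r ^ k))"
      using r by (intro abs) auto
    then have "(\<lambda>k. cscale (a k * of_real r ^ k) (zpow (int k))) sums L2_of (\<lambda>z. F (of_real r * z))"
    proof (rule L2_of_power_series)
      show "(\<lambda>k. a k * of_real r ^ k * z ^ k) sums F (of_real r * z)" if "norm z = 1" for z
        using Fs[of "of_real r * z"] r that by (simp add: norm_mult power_mult_distrib mult.assoc)
      show "(\<lambda>z. F (of_real r * z)) \<in> borel_measurable circle_measure"
        using r by (intro borel_measurable_circle_continuous continuous_dilate hol) auto
    qed
    then show ?thesis
      using Gs[of r] r sums_unique2 by auto
  qed
  have "(G \<longlongrightarrow> f) (at_left 1)"
    using continuous_on_Icc_at_leftD[OF contG] G1 by simp
  moreover have "\<forall>\<^sub>F r in at_left (1::real). G r = L2_of (\<lambda>z. F (of_real r * z))"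
    using eventually_at_left_real[of 0 "1::real"] Gr by (auto elim!: eventually_mono)
  ultimately have lim: "((\<lambda>r. L2_of (\<lambda>z. F (of_real r * z))) \<longlongrightarrow> f) (at_left (1::real))"
    by (rule Lim_transform_eventually)
  \<comment> \<open>The curve G is bounded on a compact interval, and its squared norms are the
    integral means that \<open>hardy_disc\<close> asks to be bounded.\<close>
  obtain C where C: "\<And>r. r \<in> {0..1} \<Longrightarrow> norm (G r) \<le> C"
    using compact_imp_bounded[OF compact_continuous_image[OF contG compact_Icc]] by (force simp: bounded_iff)
  have "(\<integral>z. (norm (F (of_real r * z)))\<^sup>2 \<partial>circle_measure) \<le> C\<^sup>2" if r: "r \<in> {0..<1}" for r
  proof -
    have c: "continuous_on (sphere 0 1) (\<lambda>z. F (of_real r * z))"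
      using r by (intro continuous_dilate hol) auto
    obtain B where "\<And>z. norm z = 1 \<Longrightarrow> norm (F (of_real r * z)) \<le> B"
      using compact_imp_bounded[OF compact_continuous_image[OF c compact_sphere]]
      by (force simp: bounded_iff)
    then have "sqint (\<lambda>z. F (of_real r * z))"
      by (intro sqint_bounded[of _ B] borel_measurable_circle_continuous c)
    then have "(\<integral>z. (norm (F (of_real r * z)))\<^sup>2 \<partial>circle_measure) = (norm (G r))\<^sup>2"
      using r by (subst Gr) (auto simp: norm_L2_of)
    then show ?thesis
      using C[of r] r by (auto intro!: power_mono)
  qed
  then have "hardy_disc F"
    using hol unfolding hardy_disc_def by blast
  with lim show "f \<in> H2"
    unfolding H2_def by blast
qed

section \<open>Multiplication, conjugation and flip\<close>

lemma unit_mult_cnj: "norm z = 1 \<Longrightarrow> z * cnj z = 1"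
  using complex_norm_square[of z] by simp

lemma sqint_cnj_iff: "sqint (\<lambda>z. cnj (f z)) \<longleftrightarrow> sqint f"
  using sqint_cnj[of f] sqint_cnj[of "\<lambda>z. cnj (f z)"] by auto

lemma sqint_reflect_iff: "sqint (\<lambda>z. f (cnj z)) \<longleftrightarrow> sqint f"
  using sqint_reflect[of f] sqint_reflect[of "\<lambda>z. f (cnj z)"] by auto

lemma sqint_mult_bounded:
  assumes "f \<in> borel_measurable circle_measure" "sqint g" "AE z in circle_measure. norm (f z) \<le> C"
  shows "sqint (\<lambda>z. f z * g z)"
proof -
  have g: "g \<in> borel_measurable circle_measure" "integrable circle_measure (\<lambda>z. C\<^sup>2 * (norm (g z))\<^sup>2)"
    using assms(2) by (auto simp: sqint_def)
  have "AE z in circle_measure. norm ((norm (f z * g z))\<^sup>2) \<le> norm (C\<^sup>2 * (norm (g z))\<^sup>2)"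
    using assms(3)
  proof eventually_elim
    case (elim z)
    then show ?case
      by (auto simp: norm_mult power_mult_distrib intro!: mult_right_mono power_mono)
  qed
  then have "integrable circle_measure (\<lambda>z. (norm (f z * g z))\<^sup>2)"
    using g(1) assms(1) by (intro Bochner_Integration.integrable_bound[OF g(2)]) auto
  then show ?thesis
    using g(1) assms(1) by (simp add: sqint_def)
qed

lemma sqint_mult_unimodular_iff:
  assumes [measurable]: "f \<in> borel_measurable circle_measure" "g \<in> borel_measurable circle_measure"
    and "AE z in circle_measure. norm (f z) = 1"
  shows "sqint (\<lambda>z. f z * g z) \<longleftrightarrow> sqint g"
proof -
  have "integrable circle_measure (\<lambda>z. (norm (f z * g z))\<^sup>2) \<longleftrightarrow> integrable circle_measure (\<lambda>z. (norm (g z))\<^sup>2)"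
  proof (rule integrable_cong_AE)
    show "AE z in circle_measure. (norm (f z * g z))\<^sup>2 = (norm (g z))\<^sup>2"
      using assms(3) by eventually_elim (simp add: norm_mult)
  qed auto
  then show ?thesis by (simp add: sqint_def)
qed

section \<open>Algebra of the product, conjugation, hat and flip\<close>

lemma L2_mult_commute: "f \<odot> g = g \<odot> f"
  by transfer (auto simp: L2_rel_def mult.commute sqint_const)

text \<open>A unimodular factor does not affect square integrability, so the default value 0 is
  taken on both sides or on neither. For three general factors it may occur on one side
  only.\<close>

lemma L2_mult_assoc: "unimodular u \<Longrightarrow> (u \<odot> f) \<odot> g = u \<odot> (f \<odot> g)"
proof transfer
  fix u f g :: "complex \<Rightarrow> complex"
  assume *: "L2_rel u u" "L2_rel f f" "L2_rel g g" and u: "AE z in circle_measure. norm (u z) = 1"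
  then have m [measurable]: "u \<in> borel_measurable circle_measure" "f \<in> borel_measurable circle_measure"
      "g \<in> borel_measurable circle_measure"
    by (auto simp: L2_rel_def sqint_def)
  have "sqint (\<lambda>z. u z * f z)"
    using * sqint_mult_unimodular_iff[OF m(1,2) u] by (auto simp: L2_rel_def)
  moreover have "sqint (\<lambda>z. u z * f z * g z) \<longleftrightarrow> sqint (\<lambda>z. f z * g z)"
    using sqint_mult_unimodular_iff[OF m(1) _ u, of "\<lambda>z. f z * g z"] by (simp add: mult.assoc)
  ultimately show "L2_rel
        (if sqint (\<lambda>z. (if sqint (\<lambda>z. u z * f z) then \<lambda>z. u z * f z else (\<lambda>_. 0)) z * g z)
         then \<lambda>z. (if sqint (\<lambda>z. u z * f z) then \<lambda>z. u z * f z else (\<lambda>_. 0)) z * g z else (\<lambda>_. 0))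
        (if sqint (\<lambda>z. u z * (if sqint (\<lambda>z. f z * g z) then \<lambda>z. f z * g z else (\<lambda>_. 0)) z)
         then \<lambda>z. u z * (if sqint (\<lambda>z. f z * g z) then \<lambda>z. f z * g z else (\<lambda>_. 0)) z else (\<lambda>_. 0))"
    by (auto simp: L2_rel_def sqint_const mult.assoc)
qed

lemma conjugate_mult: "conjugate (f \<odot> g) = conjugate f \<odot> conjugate g"
proof transfer
  fix f g :: "complex \<Rightarrow> complex" assume "L2_rel f f" "L2_rel g g"
  show "L2_rel (\<lambda>z. cnj ((if sqint (\<lambda>z. f z * g z) then \<lambda>z. f z * g z else (\<lambda>_. 0)) z))
     (if sqint (\<lambda>z. cnj (f z) * cnj (g z)) then \<lambda>z. cnj (f z) * cnj (g z) else (\<lambda>_. 0))"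
    using sqint_cnj_iff[of "\<lambda>z. f z * g z"] by (auto simp: L2_rel_def sqint_const)
qed

lemma hat_mult: "hat (f \<odot> g) = hat f \<odot> hat g"
proof transfer
  fix f g :: "complex \<Rightarrow> complex" assume "L2_rel f f" "L2_rel g g"
  show "L2_rel (\<lambda>z. cnj ((if sqint (\<lambda>z. f z * g z) then \<lambda>z. f z * g z else (\<lambda>_. 0)) (cnj z)))
     (if sqint (\<lambda>z. cnj (f (cnj z)) * cnj (g (cnj z))) then \<lambda>z. cnj (f (cnj z)) * cnj (g (cnj z)) else (\<lambda>_. 0))"
    using sqint_cnj_iff[of "\<lambda>z. f (cnj z) * g (cnj z)"] sqint_reflect_iff[of "\<lambda>z. f z * g z"]
    by (auto simp: L2_rel_def sqint_const)
qed

text \<open>\<open>conjugate (hat f)\<close> is f composed with the reflection of the circle; the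
  factor \<open>cnj z\<close> of the flip stays with g.\<close>

lemma flip_mult: "flip (f \<odot> g) = conjugate (hat f) \<odot> flip g"
proof transfer
  fix f g :: "complex \<Rightarrow> complex" assume *: "L2_rel f f" "L2_rel g g"
  have [measurable]: "(\<lambda>z. f (cnj z)) \<in> borel_measurable circle_measure" "(\<lambda>z. g (cnj z)) \<in> borel_measurable circle_measure"
    using * sqint_reflect by (auto simp: L2_rel_def sqint_def)
  have [measurable]: "cnj \<in> borel_measurable circle_measure"
    by (intro borel_measurable_circle_continuous continuous_intros)
  have "sqint (\<lambda>z. cnj z * (f (cnj z) * g (cnj z))) \<longleftrightarrow> sqint (\<lambda>z. f z * g z)"
    using sqint_mult_unimodular_iff[of cnj "\<lambda>z. f (cnj z) * g (cnj z)"] AE_circle_norm sqint_reflect_iff[of "\<lambda>z. f z * g z"]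
    by simp
  then show "L2_rel (\<lambda>z. cnj z * (if sqint (\<lambda>z. f z * g z) then \<lambda>z. f z * g z else (\<lambda>_. 0)) (cnj z))
     (if sqint (\<lambda>z. cnj (cnj (f (cnj z))) * (cnj z * g (cnj z)))
      then \<lambda>z. cnj (cnj (f (cnj z))) * (cnj z * g (cnj z)) else (\<lambda>_. 0))"
    by (auto simp: L2_rel_def sqint_const mult.left_commute)
qed

lemma conjugate_conjugate [simp]: "conjugate (conjugate f) = f"
  by transfer (auto simp: L2_rel_def)

lemma hat_hat [simp]: "hat (hat f) = f"
  by transfer (auto simp: L2_rel_def)

lemma hat_conjugate: "hat (conjugate f) = conjugate (hat f)"
  by transfer (auto simp: L2_rel_def intro: sqint_reflect)

lemma flip_flip [simp]: "flip (flip f) = f"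
proof transfer
  fix f assume "L2_rel f f"
  moreover have "AE z in circle_measure. cnj z * (cnj (cnj z) * f (cnj (cnj z))) = f z"
    using AE_circle_norm by eventually_elim (simp add: unit_mult_cnj mult.commute[of "cnj _"] flip: mult.assoc)
  ultimately show "L2_rel (\<lambda>z. cnj z * (cnj (cnj z) * f (cnj (cnj z)))) f"
    using sqint_cnj_ident_mult[OF sqint_reflect[OF sqint_cnj_ident_mult[OF sqint_reflect[of f]]]]
    by (auto simp: L2_rel_def)
qed

lemma hat_add: "hat (f + g) = hat f + hat g"
  by transfer (auto simp: L2_rel_def intro!: sqint_add sqint_cnj[OF sqint_reflect])

lemma hat_cscale: "hat (cscale c f) = cscale (cnj c) (hat f)"
  by transfer (auto simp: L2_rel_def sqint_reflect sqint_cnj sqint_cscale)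

lemma flip_add: "flip (f + g) = flip f + flip g"
  by transfer (auto simp: L2_rel_def distrib_left intro!: sqint_add sqint_cnj_ident_mult[OF sqint_reflect])

lemma flip_cscale: "flip (cscale c f) = cscale c (flip f)"
  by transfer (auto simp: L2_rel_def mult.left_commute intro!: sqint_cscale sqint_cnj_ident_mult[OF sqint_reflect])

lemma integral_reflect:
  fixes f :: "complex \<Rightarrow> complex"
  assumes "f \<in> borel_measurable circle_measure"
  shows "(\<integral>z. f (cnj z) \<partial>circle_measure) = (\<integral>z. f z \<partial>circle_measure)"
  using integral_distr[OF cnj_measurable_circle assms] by (simp add: distr_cnj_circle)

lemma cinner_hat: "cinner (hat f) (hat g) = cnj (cinner f g)"
proof transfer
  fix f g assume *: "L2_rel f f" "L2_rel g g"
  have "(\<lambda>z. cnj (f z) * cnj (cnj (g z))) \<in> borel_measurable circle_measure"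
    using * sqint_mult_integrable[OF sqint_cnj sqint_cnj, of f g] by (auto simp: L2_rel_def)
  from integral_reflect[OF this]
  show "(\<integral>z. cnj (f (cnj z)) * cnj (cnj (g (cnj z))) \<partial>circle_measure) = cnj (\<integral>z. f z * cnj (g z) \<partial>circle_measure)"
    by (simp flip: Bochner_Integration.integral_cnj)
qed

lemma cinner_flip: "cinner (flip f) (flip g) = cinner f g"
proof transfer
  fix f g assume *: "L2_rel f f" "L2_rel g g"
  have "(\<lambda>z. f z * cnj (g z)) \<in> borel_measurable circle_measure"
    using * sqint_mult_integrable[of f g] by (auto simp: L2_rel_def)
  from integral_reflect[OF this]
  have "(\<integral>z. f (cnj z) * cnj (g (cnj z)) \<partial>circle_measure) = (\<integral>z. f z * cnj (g z) \<partial>circle_measure)" .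
  moreover have "(\<integral>z. cnj z * f (cnj z) * cnj (cnj z * g (cnj z)) \<partial>circle_measure)
     = (\<integral>z. f (cnj z) * cnj (g (cnj z)) \<partial>circle_measure)"
    by (rule Bochner_Integration.integral_cong) (auto simp: cnj_unit field_simps)
  ultimately show "(\<integral>z. cnj z * f (cnj z) * cnj (cnj z * g (cnj z)) \<partial>circle_measure) = (\<integral>z. f z * cnj (g z) \<partial>circle_measure)"
    by simp
qed

section \<open>Unimodular and essentially bounded factors\<close>

lemma unimodular_conjugate: "unimodular u \<Longrightarrow> unimodular (conjugate u)"
  by transfer simp

lemma unimodular_hat: "unimodular u \<Longrightarrow> unimodular (hat u)"
  by transfer (drule AE_circle_cnj, simp)

lemma ess_bounded_hat: "ess_bounded (hat f) \<longleftrightarrow> ess_bounded f"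
proof -
  have "ess_bounded (hat f)" if "ess_bounded f" for f
    using that by transfer (elim exE, drule AE_circle_cnj, simp, rule exI)
  from this[of f] this[of "hat f"] show ?thesis by auto
qed

lemma ess_bounded_flip: "ess_bounded (flip f) \<longleftrightarrow> ess_bounded f"
proof -
  have "ess_bounded (flip f)" if "ess_bounded f" for f
    using that
  proof transfer
    fix f :: "complex \<Rightarrow> complex" assume "\<exists>C. AE z in circle_measure. norm (f z) \<le> C"
    then obtain C where "AE z in circle_measure. norm (f (cnj z)) \<le> C"
      using AE_circle_cnj[of "\<lambda>z. norm (f z) \<le> _"] by blast
    then have "AE z in circle_measure. norm (cnj z * f (cnj z)) \<le> C"
      using AE_circle_norm by eventually_elim (simp add: norm_mult)
    then show "\<exists>C. AE z in circle_measure. norm (cnj z * f (cnj z)) \<le> C" by blast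
  qed
  from this[of f] this[of "flip f"] show ?thesis by auto
qed

lemma conjugate_mult_cancel:
  assumes "unimodular u" shows "conjugate u \<odot> (u \<odot> f) = f"
  using assms
proof transfer
  fix u f assume *: "L2_rel u u" "L2_rel f f" and u: "AE z in circle_measure. norm (u z) = 1"
  then have "sqint (\<lambda>z. u z * f z)"
    by (subst sqint_mult_unimodular_iff) (auto simp: L2_rel_def sqint_def)
  moreover have ae: "AE z in circle_measure. f z = cnj (u z) * (u z * f z)"
    using u by eventually_elim (simp add: unit_mult_cnj mult.commute[of "cnj _"] flip: mult.assoc)
  moreover have "sqint (\<lambda>z. cnj (u z) * (u z * f z))"
    by (rule sqint_mult_bounded[where C = 1])
      (use * u \<open>sqint (\<lambda>z. u z * f z)\<close> sqint_cnj[of u] in \<open>auto simp: L2_rel_def sqint_def\<close>)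
  moreover have "AE z in circle_measure. cnj (u z) * (u z * f z) = f z"
    using ae by eventually_elim simp
  ultimately show "L2_rel
        (if sqint (\<lambda>z. cnj (u z) * (if sqint (\<lambda>z. u z * f z) then \<lambda>z. u z * f z else (\<lambda>_. 0)) z)
         then \<lambda>z. cnj (u z) * (if sqint (\<lambda>z. u z * f z) then \<lambda>z. u z * f z else (\<lambda>_. 0)) z else (\<lambda>_. 0)) f"
    using * by (simp add: L2_rel_def)
qed

lemma mult_conjugate_cancel:
  assumes "unimodular u" shows "u \<odot> (conjugate u \<odot> f) = f"
  using conjugate_mult_cancel[OF unimodular_conjugate[OF assms], of f] by simp

text \<open>Bounded arguments keep both products square integrable for an arbitrary symbol h, so no
  default value enters. This is what makes the operator formulas additive on
  \<open>bounded_part\<close>.\<close>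

lemma L2_mult_add:
  assumes "ess_bounded f" "ess_bounded g" shows "h \<odot> (f + g) = h \<odot> f + h \<odot> g"
  using assms
proof transfer
  fix f g h :: "complex \<Rightarrow> complex"
  assume *: "L2_rel f f" "L2_rel g g" "L2_rel h h"
    and b: "\<exists>C. AE z in circle_measure. norm (f z) \<le> C" "\<exists>C. AE z in circle_measure. norm (g z) \<le> C"
  have "sqint (\<lambda>z. h z * f z)" "sqint (\<lambda>z. h z * g z)"
    using b * sqint_mult_bounded[of f h] sqint_mult_bounded[of g h] by (auto simp: L2_rel_def sqint_def mult.commute)
  then show "L2_rel (if sqint (\<lambda>z. h z * (f z + g z)) then \<lambda>z. h z * (f z + g z) else (\<lambda>_. 0))
          (\<lambda>z. (if sqint (\<lambda>z. h z * f z) then \<lambda>z. h z * f z else (\<lambda>_. 0)) z +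
                (if sqint (\<lambda>z. h z * g z) then \<lambda>z. h z * g z else (\<lambda>_. 0)) z)"
    using sqint_add[of "\<lambda>z. h z * f z" "\<lambda>z. h z * g z"] by (simp add: L2_rel_def distrib_left)
qed

lemma L2_mult_cscale: "h \<odot> cscale c f = cscale c (h \<odot> f)"
\<comment> \<open>Only for nonzero c does the default value occur on both sides simultaneously; for
  c = 0 both sides vanish.\<close>
proof (cases "c = 0")
  case True
  then show ?thesis
    by simp (transfer, auto simp: L2_rel_def sqint_const)
next
  case False
  then show ?thesis
  proof transfer
    fix c :: complex and f h :: "complex \<Rightarrow> complex" assume "c \<noteq> 0"
    then have "sqint (\<lambda>z. h z * (c * f z)) \<longleftrightarrow> sqint (\<lambda>z. h z * f z)"
      using sqint_cscale[of "\<lambda>z. h z * f z" c] sqint_cscale[of "\<lambda>z. h z * (c * f z)" "inverse c"]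
      by (auto simp: field_simps)
    then show "L2_rel (if sqint (\<lambda>z. h z * (c * f z)) then \<lambda>z. h z * (c * f z) else (\<lambda>_. 0))
          (\<lambda>z. c * (if sqint (\<lambda>z. h z * f z) then \<lambda>z. h z * f z else (\<lambda>_. 0)) z)"
      using sqint_cscale[of "\<lambda>z. h z * f z" c] by (auto simp: L2_rel_def sqint_const mult.left_commute)
  qed
qed

lemma unimodular_mult_add:
  assumes "unimodular u" shows "u \<odot> (f + g) = u \<odot> f + u \<odot> g"
  using assms
proof transfer
  fix f g u :: "complex \<Rightarrow> complex"
  assume *: "L2_rel u u" "L2_rel f f" "L2_rel g g" and u: "AE z in circle_measure. norm (u z) = 1"
  then have "sqint (\<lambda>z. u z * f z)" "sqint (\<lambda>z. u z * g z)"
    by (simp_all add: sqint_mult_unimodular_iff L2_rel_def sqint_def[of u] sqint_measurable)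
  then show "L2_rel (if sqint (\<lambda>z. u z * (f z + g z)) then \<lambda>z. u z * (f z + g z) else (\<lambda>_. 0))
          (\<lambda>z. (if sqint (\<lambda>z. u z * f z) then \<lambda>z. u z * f z else (\<lambda>_. 0)) z +
                (if sqint (\<lambda>z. u z * g z) then \<lambda>z. u z * g z else (\<lambda>_. 0)) z)"
    using sqint_add[of "\<lambda>z. u z * f z" "\<lambda>z. u z * g z"] by (simp add: L2_rel_def distrib_left)
qed

lemma cinner_mult_left:
  assumes "unimodular u" shows "cinner (u \<odot> f) g = cinner f (conjugate u \<odot> g)"
  using assms
proof transfer
  fix f g u :: "complex \<Rightarrow> complex"
  assume *: "L2_rel u u" "L2_rel f f" "L2_rel g g" and u: "AE z in circle_measure. norm (u z) = 1"
  have [measurable]: "u \<in> borel_measurable circle_measure" "(\<lambda>z. cnj (u z)) \<in> borel_measurable circle_measure"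
    using * sqint_cnj[of u] by (auto simp: L2_rel_def sqint_def)
  have "sqint (\<lambda>z. u z * f z)" "sqint (\<lambda>z. cnj (u z) * g z)"
    using * u by (simp_all add: sqint_mult_unimodular_iff L2_rel_def sqint_measurable)
  then show "(\<integral>z. (if sqint (\<lambda>z. u z * f z) then \<lambda>z. u z * f z else (\<lambda>_. 0)) z * cnj (g z) \<partial>circle_measure) =
       (\<integral>z. f z * cnj ((if sqint (\<lambda>z. cnj (u z) * g z) then \<lambda>z. cnj (u z) * g z else (\<lambda>_. 0)) z) \<partial>circle_measure)"
    by (simp add: ac_simps)
qed

lemma cinner_mult_mult: "unimodular u \<Longrightarrow> cinner (u \<odot> f) (u \<odot> g) = cinner f g"
  by (simp add: cinner_mult_left conjugate_mult_cancel)

lemma norm_eq_if_cinner_eq: "cinner f f = cinner g g \<Longrightarrow> norm f = norm g"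
  by (simp add: cinner_self power2_eq_iff_nonneg flip: of_real_power)

lemma norm_unimodular_mult: "unimodular u \<Longrightarrow> norm (u \<odot> f) = norm f"
  by (intro norm_eq_if_cinner_eq cinner_mult_mult)

lemma norm_hat [simp]: "norm (hat f) = norm f"
  by (intro norm_eq_if_cinner_eq) (simp only: cinner_hat, rule cinner_commute[symmetric])

lemma norm_flip [simp]: "norm (flip f) = norm f"
  by (intro norm_eq_if_cinner_eq cinner_flip)

lemma bounded_linear_unimodular_mult: "unimodular u \<Longrightarrow> bounded_linear (\<lambda>f. u \<odot> f)"
  by (rule bounded_linear_intro[of _ 1])
    (auto simp: unimodular_mult_add scaleR_L2_def L2_mult_cscale norm_unimodular_mult)

lemma ess_bounded_add: "ess_bounded f \<Longrightarrow> ess_bounded g \<Longrightarrow> ess_bounded (f + g)"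
proof transfer
  fix f g :: "complex \<Rightarrow> complex"
  assume "\<exists>C. AE z in circle_measure. norm (f z) \<le> C" "\<exists>C. AE z in circle_measure. norm (g z) \<le> C"
  then obtain C D where "AE z in circle_measure. norm (f z) \<le> C" "AE z in circle_measure. norm (g z) \<le> D"
    by blast
  then have "AE z in circle_measure. norm (f z + g z) \<le> C + D"
    by eventually_elim (rule norm_triangle_mono)
  then show "\<exists>C. AE z in circle_measure. norm (f z + g z) \<le> C" by blast
qed

lemma ess_bounded_cscale: "ess_bounded f \<Longrightarrow> ess_bounded (cscale c f)"
proof transfer
  fix f :: "complex \<Rightarrow> complex" and c
  assume "\<exists>C. AE z in circle_measure. norm (f z) \<le> C"
  then obtain C where "AE z in circle_measure. norm (f z) \<le> C" by blast
  then have "AE z in circle_measure. norm (c * f z) \<le> cmod c * C"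
    by eventually_elim (simp add: norm_mult mult_left_mono)
  then show "\<exists>C. AE z in circle_measure. norm (c * f z) \<le> C" by blast
qed

lemma ess_bounded_unimodular_mult:
  assumes "unimodular u" shows "ess_bounded (u \<odot> f) \<longleftrightarrow> ess_bounded f"
proof -
  have "ess_bounded (u \<odot> f)" if "ess_bounded f" "unimodular u" for u f
    using that
  proof transfer
    fix u f :: "complex \<Rightarrow> complex"
    assume *: "\<exists>C. AE z in circle_measure. norm (f z) \<le> C" "AE z in circle_measure. norm (u z) = 1"
      "L2_rel f f" "L2_rel u u"
    then obtain C where "AE z in circle_measure. norm (f z) \<le> C" by blast
    with *(2) have "AE z in circle_measure. norm (u z * f z) \<le> C"
      by eventually_elim (simp add: norm_mult)
    moreover have "sqint (\<lambda>z. u z * f z)"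
      using * by (simp add: sqint_mult_unimodular_iff L2_rel_def sqint_measurable)
    ultimately show "\<exists>C. AE z in circle_measure. norm ((if sqint (\<lambda>z. u z * f z) then \<lambda>z. u z * f z else (\<lambda>_. 0)) z) \<le> C"
      by auto
  qed
  from this[of f u] this[of "u \<odot> f" "conjugate u"] show ?thesis
    using assms by (auto simp: unimodular_conjugate conjugate_mult_cancel)
qed

lemma minus_L2_conv: "f - g = f + cscale (-1) g" for f g :: L2
  by transfer (auto simp: L2_rel_def intro: sqint_diff)

lemma ess_bounded_zero: "ess_bounded 0"
  by transfer auto

lemma ess_bounded_sum: "(\<And>k. k \<in> S \<Longrightarrow> ess_bounded (f k)) \<Longrightarrow> ess_bounded (sum f S)"
  by (induction S rule: infinite_finite_induct) (auto simp: ess_bounded_zero ess_bounded_add)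

lemma hat_diff: "hat (f - g) = hat f - hat g"
  by (simp add: minus_L2_conv hat_add hat_cscale)

lemma flip_diff: "flip (f - g) = flip f - flip g"
  by (simp add: minus_L2_conv flip_add flip_cscale)

section \<open>Action on the characters\<close>

lemma unimodular_zpow: "unimodular (zpow n)"
  unfolding zpow_def
  by transfer (auto simp: sqint_powi norm_power_int intro!: AE_I2)

lemma ess_bounded_zpow: "ess_bounded (zpow n)"
  unfolding zpow_def
  by transfer (auto simp: sqint_powi norm_power_int intro!: exI[of _ 1] AE_I2)

lemma zpow_mult_zpow: "zpow m \<odot> zpow n = zpow (m + n)"
proof -
  have "sqint (\<lambda>z. z powi m * z powi n)"
    by (rule sqint_bounded[of _ 1]) (auto simp: norm_mult norm_power_int)
  moreover have "AE z in circle_measure. z powi m * z powi n = z powi (m + n)"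
    using AE_circle_norm
  proof eventually_elim
    case (elim z)
    then have "z \<noteq> 0" by auto
    then show ?case by (simp add: power_int_add)
  qed
  ultimately show ?thesis
    unfolding zpow_def by transfer (auto simp: L2_rel_def sqint_powi)
qed

lemma conjugate_zpow: "conjugate (zpow n) = zpow (- n)"
proof -
  have "AE z in circle_measure. cnj (z powi n) = z powi (- n)"
    using AE_circle_norm by eventually_elim (auto simp: cnj_unit power_int_minus power_int_inverse)
  then show ?thesis
    unfolding zpow_def using sqint_cnj[OF sqint_powi[of n]] by transfer (simp add: L2_rel_def sqint_powi)
qed

lemma hat_zpow: "hat (zpow n) = zpow n"
  unfolding zpow_def by transfer (auto simp: L2_rel_def sqint_powi)

text \<open>The shift by one makes J exchange the frequencies n \<ge> 0 with the frequencies n < 0,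
  that is, H2 with its orthogonal complement.\<close>

lemma flip_zpow: "flip (zpow n) = zpow (- n - 1)"
proof -
  have "AE z in circle_measure. cnj z * (cnj z) powi n = z powi (- n - 1)"
    using AE_circle_norm
  proof eventually_elim
    case (elim z)
    then have "z \<noteq> 0" by auto
    then show ?case
      unfolding cnj_unit[OF elim] using power_int_diff[of z "- n" 1]
      by (simp add: power_int_inverse power_int_minus field_simps)
  qed
  then show ?thesis
    unfolding zpow_def using sqint_cnj_ident_mult[OF sqint_reflect[OF sqint_powi[of n]]]
    by transfer (simp add: L2_rel_def sqint_powi)
qed

section \<open>Inner functions and model spaces\<close>

lemma H2_add: "f \<in> H2 \<Longrightarrow> g \<in> H2 \<Longrightarrow> f + g \<in> H2"
  by (simp add: H2_iff cinner_add_left)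

lemma H2_diff: "f \<in> H2 \<Longrightarrow> g \<in> H2 \<Longrightarrow> f - g \<in> H2"
  by (simp add: H2_iff cinner_diff_left)

lemma H2_cscale: "f \<in> H2 \<Longrightarrow> cscale c f \<in> H2"
  by (simp add: H2_iff cinner_cscale_left)

lemma H2_zpow: "0 \<le> n \<Longrightarrow> zpow n \<in> H2"
  by (simp add: H2_iff cinner_zpow_zpow)

lemma H2_hat: "f \<in> H2 \<Longrightarrow> hat f \<in> H2"
  using cinner_hat[of f "zpow _"] by (simp add: H2_iff hat_zpow)

lemma Riesz_proj_in_H2: "Riesz_proj f \<in> H2"
  by (simp add: H2_iff cinner_Riesz_proj)

lemma H2_sums: "f \<in> H2 \<Longrightarrow> (\<lambda>k. cscale (cinner f (zpow (int k))) (zpow (int k))) sums f"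
  by (rule zpow_series_eq) (simp add: H2_iff)

text \<open>Reduces claims about H2 to characters by continuity. Linearity is over the reals and the
  scalar c is left free, so that the antilinear second argument of \<open>cinner\<close> is covered
  too.\<close>

lemma sums_zero_if_terms_zero:
  assumes "bounded_linear F" "f \<in> H2" "\<And>k c. F (cscale c (zpow (int k))) = 0" shows "F f = 0"
proof -
  have "(\<lambda>k. F (cscale (cinner f (zpow (int k))) (zpow (int k)))) sums F f"
    using assms(1) H2_sums[OF assms(2)] by (rule bounded_linear.sums)
  then show ?thesis
    using assms(3) sums_unique by fastforce
qed

lemma cinner_Riesz_proj_H2:
  assumes "h \<in> H2" shows "cinner (f - Riesz_proj f) h = 0"
  using bounded_linear_cinner_right assms
  by (rule sums_zero_if_terms_zero) (simp add: cinner_cscale_right cinner_diff_left cinner_Riesz_proj)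

lemma cinner_Riesz_proj_left: "h \<in> H2 \<Longrightarrow> cinner (Riesz_proj f) h = cinner f h"
  using cinner_Riesz_proj_H2[of h f] by (simp add: cinner_diff_left)

text \<open>The difference of two candidates lies in M and is orthogonal to itself, so closure under
  differences already gives the uniqueness that \<open>THE\<close> asks for.\<close>

lemma orth_proj_eqI:
  assumes "g \<in> M" "\<And>h. h \<in> M \<Longrightarrow> cinner (f - g) h = 0"
    and diff: "\<And>h k. h \<in> M \<Longrightarrow> k \<in> M \<Longrightarrow> h - k \<in> M"
  shows "orth_proj M f = g"
  unfolding orth_proj_def
proof (rule the_equality)
  fix g' assume g': "g' \<in> M \<and> (\<forall>h\<in>M. cinner (f - g') h = 0)"
  have "cinner (g' - g) (g' - g) = cinner (f - g) (g' - g) - cinner (f - g') (g' - g)"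
    by (simp flip: cinner_diff_left)
  also have "\<dots> = 0"
    using assms g' by auto
  finally show "g' = g"
    by (simp add: cinner_self_eq_0)
qed (use assms in auto)

lemma orth_proj_H2: "orth_proj H2 f = Riesz_proj f"
  by (intro orth_proj_eqI Riesz_proj_in_H2 cinner_Riesz_proj_H2 H2_diff)

lemma cinner_mult_zpow: "cinner (u \<odot> zpow k) (zpow n) = cinner u (zpow (n - k))"
  by (subst L2_mult_commute) (simp add: cinner_mult_left unimodular_zpow conjugate_zpow zpow_mult_zpow)

lemma inner_fun_unimodular: "inner_fun u \<Longrightarrow> unimodular u"
  by (simp add: inner_fun_def)

text \<open>Multiplication by u is continuous on L2, so it suffices to take f to be a character, and
  then the coefficients of u are merely shifted upwards.\<close>

lemma inner_fun_mult_H2: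
  assumes u: "inner_fun u" and f: "f \<in> H2" shows "u \<odot> f \<in> H2"
  unfolding H2_iff
proof (intro allI impI)
  fix n :: int assume n: "n < 0"
  have "bounded_linear (\<lambda>f. cinner (u \<odot> f) (zpow n))"
    using bounded_linear_unimodular_mult[OF inner_fun_unimodular[OF u]] bounded_linear_cinner_left
    by (rule bounded_linear_compose[rotated])
  then show "cinner (u \<odot> f) (zpow n) = 0"
    using f
  proof (rule sums_zero_if_terms_zero)
    show "cinner (u \<odot> cscale c (zpow (int k))) (zpow n) = 0" for k c
      using u n by (simp add: L2_mult_cscale cinner_cscale_left cinner_mult_zpow inner_fun_def H2_iff)
  qed
qed

lemma inner_fun_hat: "inner_fun u \<Longrightarrow> inner_fun (hat u)"
  by (simp add: inner_fun_def H2_hat unimodular_hat)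

text \<open>By \<open>flip_zpow\<close>, J moves all frequencies of f to negative ones. This yields
  both the simplified Hankel formula and the invariance of model spaces under
  \<open>hat_flip\<close>.\<close>

lemma cinner_flip_H2:
  assumes "f \<in> H2" "g \<in> H2" shows "cinner (flip f) g = 0"
  using bounded_linear_cinner_right assms(2)
proof (rule sums_zero_if_terms_zero)
  fix k c
  have "cinner (flip f) (zpow (int k)) = cinner f (flip (zpow (int k)))"
    using cinner_flip[of f "flip (zpow (int k))"] by simp
  then show "cinner (flip f) (cscale c (zpow (int k))) = 0"
    using assms(1) by (simp add: cinner_cscale_right flip_zpow H2_iff)
qed

section \<open>Model spaces and their projections\<close>

lemma model_space_H2: "f \<in> model_space u \<Longrightarrow> f \<in> H2"
  by (simp add: model_space_def)

lemma model_space_add: "f \<in> model_space u \<Longrightarrow> g \<in> model_space u \<Longrightarrow> f + g \<in> model_space u"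
  by (simp add: model_space_def H2_add cinner_add_left)

lemma model_space_diff: "f \<in> model_space u \<Longrightarrow> g \<in> model_space u \<Longrightarrow> f - g \<in> model_space u"
  by (simp add: model_space_def H2_diff cinner_diff_left)

lemma model_space_cscale: "f \<in> model_space u \<Longrightarrow> cscale c f \<in> model_space u"
  by (simp add: model_space_def H2_cscale cinner_cscale_left)

lemma closed_model_space: "closed (model_space u)"
proof -
  have "closed {f. cinner f g = 0}" for g
    by (intro closed_Collect_eq bounded_linear.continuous_on[OF bounded_linear_cinner_left] continuous_intros)
  moreover have "model_space u = (\<Inter>n\<in>{..<0}. {f. cinner f (zpow n) = 0}) \<inter> (\<Inter>g\<in>H2. {f. cinner f (u \<odot> g) = 0})"
    by (auto simp: model_space_def H2_iff)
  ultimately show ?thesis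
    by (simp add: closed_INT closed_Int)
qed

text \<open>The classical formula for P_u: from P one subtracts the projection onto u H2, which is P
  conjugated by the unitary multiplication by u.\<close>

definition model_proj :: "L2 \<Rightarrow> L2 \<Rightarrow> L2" where
  "model_proj u g = Riesz_proj g - u \<odot> Riesz_proj (conjugate u \<odot> g)"

lemma model_proj:
  assumes u: "inner_fun u"
  shows "model_proj u g \<in> model_space u"
    and "h \<in> model_space u \<Longrightarrow> cinner (g - model_proj u g) h = 0"
proof -
  note um = inner_fun_unimodular[OF u]
  have "cinner (model_proj u g) (u \<odot> h) = 0" if h: "h \<in> H2" for h
  proof -
    have "cinner (Riesz_proj g) (u \<odot> h) = cinner g (u \<odot> h)"
      using inner_fun_mult_H2[OF u h] by (rule cinner_Riesz_proj_left)
    also have "\<dots> = cinner (conjugate u \<odot> g) h"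
      using um by (simp add: cinner_mult_left unimodular_conjugate)
    also have "\<dots> = cinner (Riesz_proj (conjugate u \<odot> g)) h"
      using h by (simp add: cinner_Riesz_proj_left)
    also have "\<dots> = cinner (u \<odot> Riesz_proj (conjugate u \<odot> g)) (u \<odot> h)"
      using um by (simp add: cinner_mult_mult)
    finally show ?thesis
      by (simp add: model_proj_def cinner_diff_left)
  qed
  then show "model_proj u g \<in> model_space u"
    unfolding model_space_def
    by (auto simp: model_proj_def intro: H2_diff Riesz_proj_in_H2 inner_fun_mult_H2 u)
  assume h: "h \<in> model_space u"
  have "cinner h (u \<odot> Riesz_proj (conjugate u \<odot> g)) = 0"
    using h Riesz_proj_in_H2 by (simp add: model_space_def)
  then have "cinner (u \<odot> Riesz_proj (conjugate u \<odot> g)) h = 0"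
    by (subst cinner_commute) simp
  then show "cinner (g - model_proj u g) h = 0"
    using cinner_Riesz_proj_left[OF model_space_H2[OF h], of g]
    by (simp add: model_proj_def cinner_diff_left)
qed

lemma orth_proj_model_space: "inner_fun u \<Longrightarrow> orth_proj (model_space u) g = model_proj u g"
  by (intro orth_proj_eqI model_proj model_space_diff)

lemma model_proj_eqI:
  assumes "inner_fun u" "k \<in> model_space u" "\<And>h. h \<in> model_space u \<Longrightarrow> cinner (g - k) h = 0"
  shows "model_proj u g = k"
  using orth_proj_eqI[OF assms(2,3) model_space_diff] orth_proj_model_space[OF assms(1), of g] by simp

lemma model_proj_add: "inner_fun u \<Longrightarrow> model_proj u (f + g) = model_proj u f + model_proj u g"
  by (rule model_proj_eqI)
    (simp_all add: model_space_add model_proj(1) add_diff_add cinner_add_left model_proj(2))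

lemma model_proj_cscale: "inner_fun u \<Longrightarrow> model_proj u (cscale c g) = cscale c (model_proj u g)"
  by (rule model_proj_eqI)
    (simp_all add: model_space_cscale model_proj(1) cinner_cscale_left model_proj(2) flip: cscale_diff_right)

lemma model_proj_ident: "inner_fun u \<Longrightarrow> f \<in> model_space u \<Longrightarrow> model_proj u f = f"
  by (rule model_proj_eqI) simp_all

lemma bounded_linear_model_proj:
  assumes u: "inner_fun u" shows "bounded_linear (model_proj u)"
proof (rule bounded_linear_intro[of _ 1])
  show "norm (model_proj u f) \<le> norm f * 1" for f
  proof -
    have "cinner (model_proj u f) (model_proj u f) = cinner f (model_proj u f)"
      using model_proj(2)[OF u model_proj(1)[OF u], of f f] by (simp add: cinner_diff_left)
    then have "(norm (model_proj u f))\<^sup>2 = cmod (cinner f (model_proj u f))"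
      by (metis cinner_self norm_of_real abs_of_nonneg zero_le_power2)
    also have "\<dots> \<le> norm f * norm (model_proj u f)"
      by (rule norm_cinner_le)
    finally show ?thesis
      by (cases "norm (model_proj u f) = 0") (simp_all add: power2_eq_square)
  qed
qed (simp_all add: u model_proj_add model_proj_cscale scaleR_L2_def)

text \<open>
  The projection of a power of z onto a model space is bounded, because the analytic part of
  conjugate u times that power is a polynomial.
\<close>

lemma model_proj_zpow_bounded_part:
  assumes u: "inner_fun u" shows "model_proj u (zpow (int k)) \<in> bounded_part u"
proof -
  note um = inner_fun_unimodular[OF u]
  \<comment> \<open>The conjugate of u has no positive frequencies, so after multiplication by the
    k-th power none above k remain.\<close>
  have zero: "cinner (conjugate u \<odot> zpow (int k)) (zpow (int j)) = 0" if "j > k" for j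
  proof -
    have "cinner (conjugate u \<odot> zpow (int k)) (zpow (int j)) = cinner (zpow (int k)) (u \<odot> zpow (int j))"
      using um by (simp add: cinner_mult_left unimodular_conjugate)
    also have "\<dots> = cnj (cinner (u \<odot> zpow (int j)) (zpow (int k)))"
      by (rule cinner_commute)
    also have "\<dots> = 0"
      using u that by (simp add: cinner_mult_zpow inner_fun_def H2_iff)
    finally show ?thesis .
  qed
  let ?t = "\<lambda>j. cscale (cinner (conjugate u \<odot> zpow (int k)) (zpow (int j))) (zpow (int j))"
  have "?t sums (\<Sum>j\<le>k. ?t j)"
    by (rule sums_finite) (auto simp: zero)
  then have "Riesz_proj (conjugate u \<odot> zpow (int k)) = (\<Sum>j\<le>k. ?t j)"
    using sums_Riesz_proj sums_unique2 by blast
  then have "ess_bounded (Riesz_proj (conjugate u \<odot> zpow (int k)))"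
    by (simp add: ess_bounded_sum ess_bounded_cscale ess_bounded_zpow)
  moreover have "Riesz_proj (zpow (int k)) = zpow (int k)"
    by (rule L2_eqI) (auto simp: cinner_Riesz_proj cinner_zpow_zpow)
  ultimately have "ess_bounded (model_proj u (zpow (int k)))"
    using um unfolding model_proj_def minus_L2_conv
    by (simp add: ess_bounded_add ess_bounded_zpow ess_bounded_cscale ess_bounded_unimodular_mult)
  then show ?thesis
    using model_proj(1)[OF u] by (simp add: bounded_part_def)
qed

section \<open>Bounded functions in a model space\<close>

lemma bounded_part_model_space: "f \<in> bounded_part u \<Longrightarrow> f \<in> model_space u"
  by (simp add: bounded_part_def)

lemma bounded_part_add: "f \<in> bounded_part u \<Longrightarrow> g \<in> bounded_part u \<Longrightarrow> f + g \<in> bounded_part u"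
  by (simp add: bounded_part_def model_space_add ess_bounded_add)

lemma bounded_part_cscale: "f \<in> bounded_part u \<Longrightarrow> cscale c f \<in> bounded_part u"
  by (simp add: bounded_part_def model_space_cscale ess_bounded_cscale)

lemma bounded_part_diff: "f \<in> bounded_part u \<Longrightarrow> g \<in> bounded_part u \<Longrightarrow> f - g \<in> bounded_part u"
  by (simp add: minus_L2_conv bounded_part_add bounded_part_cscale)

lemma zero_bounded_part: "0 \<in> bounded_part u"
  by (simp add: bounded_part_def model_space_def H2_iff ess_bounded_zero)

text \<open>The partial Fourier sums of f converge to f, and projecting them to K_u keeps the limit.
  The projected sums are bounded functions because the projected characters are.\<close>

lemma bounded_part_dense:
  assumes u: "inner_fun u" shows "closure (bounded_part u) = model_space u"
proof
  show "closure (bounded_part u) \<subseteq> model_space u"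
    by (intro closure_minimal closed_model_space subsetI bounded_part_model_space)
  show "model_space u \<subseteq> closure (bounded_part u)"
  proof
    fix f assume f: "f \<in> model_space u"
    have "(\<lambda>k. model_proj u (cscale (cinner f (zpow (int k))) (zpow (int k)))) sums model_proj u f"
      by (intro bounded_linear.sums[OF bounded_linear_model_proj[OF u]] H2_sums model_space_H2[OF f])
    then have "(\<lambda>N. \<Sum>k<N. model_proj u (cscale (cinner f (zpow (int k))) (zpow (int k)))) \<longlonglongrightarrow> f"
      using u f by (simp add: sums_def model_proj_ident)
    moreover have "(\<Sum>k<N. model_proj u (cscale (cinner f (zpow (int k))) (zpow (int k)))) \<in> bounded_part u" for N
      by (induction N)
        (simp_all add: zero_bounded_part u model_proj_cscale bounded_part_add bounded_part_cscale model_proj_zpow_bounded_part)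
    ultimately show "f \<in> closure (bounded_part u)"
      unfolding closure_sequential
      by (intro exI[of _ "\<lambda>N. \<Sum>k<N. model_proj u (cscale (cinner f (zpow (int k))) (zpow (int k)))"] conjI allI)
  qed
qed

section \<open>Extension of densely defined operators\<close>

text \<open>Kept apart from \<open>bounded_on\<close>: the truncated Toeplitz and Hankel formulas
  have this property for every symbol, whereas boundedness is a condition on the symbol.\<close>

definition linear_into :: "L2 \<Rightarrow> L2 \<Rightarrow> (L2 \<Rightarrow> L2) \<Rightarrow> bool" where
  "linear_into u v D \<longleftrightarrow>
     (\<forall>f\<in>bounded_part u. D f \<in> model_space v) \<and>
     (\<forall>f\<in>bounded_part u. \<forall>g\<in>bounded_part u. D (f + g) = D f + D g) \<and>
     (\<forall>c. \<forall>f\<in>bounded_part u. D (cscale c f) = cscale c (D f))"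

lemma bounded_operator_diff:
  assumes "bounded_operator u v T" "f \<in> model_space u" "g \<in> model_space u"
  shows "T (f - g) = T f - T g"
  using assms unfolding minus_L2_conv bounded_operator_def by (simp add: model_space_cscale)

lemma bounded_operator_continuous:
  assumes T: "bounded_operator u v T" shows "continuous_on (model_space u) T"
proof -
  obtain C where C: "\<And>f. f \<in> model_space u \<Longrightarrow> norm (T f) \<le> C * norm f"
    using T unfolding bounded_operator_def by blast
  have "norm (T f) \<le> \<bar>C\<bar> * norm f" if "f \<in> model_space u" for f
    using C[OF that] mult_right_mono[OF abs_ge_self[of C] norm_ge_zero[of f]] by linarith
  then have "dist (T f) (T g) \<le> \<bar>C\<bar> * dist f g" if "f \<in> model_space u" "g \<in> model_space u" for f g
    using that model_space_diff[OF that] by (simp only: dist_norm flip: bounded_operator_diff[OF T])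
  then have "\<bar>C\<bar>-lipschitz_on (model_space u) T"
    by (intro lipschitz_onI) auto
  then show ?thesis
    by (rule lipschitz_on_continuous_on)
qed

text \<open>On the source the two continuous maps agree on a dense subset; off the source both are 0
  by the convention for operators.\<close>

lemma bounded_operator_eqI:
  assumes u: "inner_fun u" and T: "bounded_operator u v T" "bounded_operator u v T'"
    and eq: "\<And>f. f \<in> bounded_part u \<Longrightarrow> T f = T' f"
  shows "T = T'"
proof
  fix f show "T f = T' f"
  proof (cases "f \<in> model_space u")
    case True
    have "continuous_on (closure (bounded_part u)) (\<lambda>f. T f - T' f)"
      unfolding bounded_part_dense[OF u] by (intro continuous_intros bounded_operator_continuous[OF T(1)]
        bounded_operator_continuous[OF T(2)])
    then have "T f - T' f = 0"
      by (rule continuous_constant_on_closure) (use True eq bounded_part_dense[OF u] in auto)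
    then show ?thesis by simp
  next
    case False
    then show ?thesis using T by (simp add: bounded_operator_def)
  qed
qed

text \<open>This is how \<open>A_op\<close> and \<open>B_op\<close> are computed: any bounded
  operator with the right values on bounded functions is the extension.\<close>

lemma bounded_extension_eqI:
  assumes "inner_fun u" "bounded_operator u v T" "\<And>f. f \<in> bounded_part u \<Longrightarrow> T f = D f"
  shows "bounded_extension u v D = T"
  unfolding bounded_extension_def
proof (rule the_equality)
  fix T' assume "bounded_operator u v T' \<and> (\<forall>f\<in>bounded_part u. T' f = D f)"
  then show "T' = T"
    by (intro bounded_operator_eqI[OF assms(1) _ assms(2)]) (simp_all add: assms(3))
qed (simp add: assms(2,3))

lemma bounded_operator_bounded_on:
  assumes "bounded_operator u v T" "\<And>f. f \<in> bounded_part u \<Longrightarrow> T f = D f"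
  shows "bounded_on u D"
proof -
  obtain C where "\<forall>f\<in>model_space u. norm (T f) \<le> C * norm f"
    using assms(1) unfolding bounded_operator_def by blast
  then show ?thesis
    using assms(2) unfolding bounded_on_def by (intro exI[of _ C]) (simp add: bounded_part_model_space flip: assms(2))
qed

text \<open>A bounded linear formula is Lipschitz, hence uniformly continuous, and extends to the
  closure because L2 is complete. By density this closure is all of K_u, and linearity and the bound
  pass to limits.\<close>

lemma bounded_extension_exists:
  assumes u: "inner_fun u" and D: "linear_into u v D" and bdd: "bounded_on u D"
  obtains T where "bounded_operator u v T" "\<And>f. f \<in> bounded_part u \<Longrightarrow> T f = D f"
proof -
  obtain C' where C': "\<And>f. f \<in> bounded_part u \<Longrightarrow> norm (D f) \<le> C' * norm f"
    using bdd by (auto simp: bounded_on_def)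
  \<comment> \<open>\<open>bounded_on\<close> puts no sign condition on its constant, while a
    Lipschitz constant has to be nonnegative.\<close>
  define C where "C = \<bar>C'\<bar>"
  have C: "C \<ge> 0" "norm (D f) \<le> C * norm f" if "f \<in> bounded_part u" for f
    using C'[OF that] mult_right_mono[OF abs_ge_self[of C'] norm_ge_zero[of f]] by (auto simp: C_def)
  have Dadd: "D (f + g) = D f + D g" if "f \<in> bounded_part u" "g \<in> bounded_part u" for f g
    using D that by (simp add: linear_into_def)
  have Dsc: "D (cscale c f) = cscale c (D f)" if "f \<in> bounded_part u" for f c
    using D that by (simp add: linear_into_def)
  have diff: "D (f - g) = D f - D g" if "f \<in> bounded_part u" "g \<in> bounded_part u" for f g
    using that unfolding minus_L2_conv by (simp add: Dadd Dsc bounded_part_cscale)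
  have "dist (D f) (D g) \<le> C * dist f g" if "f \<in> bounded_part u" "g \<in> bounded_part u" for f g
    using C(2)[OF bounded_part_diff[OF that]] by (simp only: dist_norm diff[OF that])
  then have "C-lipschitz_on (bounded_part u) D"
    by (intro lipschitz_onI) (auto simp: C_def)
  then have "uniformly_continuous_on (bounded_part u) D"
    by (rule lipschitz_on_uniformly_continuous)
  then obtain g where g: "uniformly_continuous_on (closure (bounded_part u)) g" "\<And>x. x \<in> bounded_part u \<Longrightarrow> D x = g x"
    by (rule uniformly_continuous_on_extension_on_closure) blast
  have gc: "continuous_on (model_space u) g"
    using uniformly_continuous_imp_continuous[OF g(1)] by (simp add: bounded_part_dense[OF u])
  have seq: "\<exists>x. (\<forall>n. x n \<in> bounded_part u) \<and> x \<longlonglongrightarrow> f \<and> (\<lambda>n. D (x n)) \<longlonglongrightarrow> g f" if f: "f \<in> model_space u" for f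
  proof -
    obtain x where x: "\<And>n. x n \<in> bounded_part u" "x \<longlonglongrightarrow> f"
      using f closure_sequential[of f "bounded_part u"] by (auto simp: bounded_part_dense[OF u])
    have "(\<lambda>n. g (x n)) \<longlonglongrightarrow> g f"
      using x by (intro continuous_on_tendsto_compose[OF gc _ f]) (auto intro!: always_eventually bounded_part_model_space)
    then have "(\<lambda>n. D (x n)) \<longlonglongrightarrow> g f"
      using x(1) g(2) by simp
    then show ?thesis using x by blast
  qed
  \<comment> \<open>Any approximating sequence of bounded functions determines the extension at f,
    so scalar multiples and sums can be computed on combinations of sequences.\<close>
  have lim: "h = g f" if "f \<in> model_space u" "\<And>n. x n \<in> bounded_part u" "x \<longlonglongrightarrow> f" "(\<lambda>n. D (x n)) \<longlonglongrightarrow> h" for f x h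
  proof -
    have "(\<lambda>n. g (x n)) \<longlonglongrightarrow> g f"
      using that by (intro continuous_on_tendsto_compose[OF gc]) (auto intro!: always_eventually bounded_part_model_space)
    then have "(\<lambda>n. D (x n)) \<longlonglongrightarrow> g f"
      using that(2) g(2) by simp
    then show ?thesis
      using that(4) LIMSEQ_unique by blast
  qed
  define T where "T f = (if f \<in> model_space u then g f else 0)" for f
  have "bounded_operator u v T"
    unfolding bounded_operator_def
  proof (intro conjI ballI allI impI)
    fix f assume f: "f \<in> model_space u"
    from seq[OF f] obtain x where x: "\<And>n. x n \<in> bounded_part u" "x \<longlonglongrightarrow> f" "(\<lambda>n. D (x n)) \<longlonglongrightarrow> g f"
      by blast
    have "D (x n) \<in> model_space v" for n
      using D x(1) by (simp add: linear_into_def)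
    then show "T f \<in> model_space v"
      using closed_sequentially[OF closed_model_space _ x(3)] f by (simp add: T_def)
    show "T (cscale c f) = cscale c (T f)" for c
    proof -
      have "cscale c (g f) = g (cscale c f)"
        using bounded_linear.tendsto[OF bounded_linear_cscale x(2)] bounded_linear.tendsto[OF bounded_linear_cscale x(3)] x(1)
        by (intro lim[of _ "\<lambda>n. cscale c (x n)"]) (simp_all add: Dsc f model_space_cscale bounded_part_cscale)
      then show ?thesis using f by (simp add: T_def model_space_cscale)
    qed
    fix h assume h: "h \<in> model_space u"
    from seq[OF h] obtain y where y: "\<And>n. y n \<in> bounded_part u" "y \<longlonglongrightarrow> h" "(\<lambda>n. D (y n)) \<longlonglongrightarrow> g h"
      by blast
    have "g f + g h = g (f + h)"
      using tendsto_add[OF x(2) y(2)] tendsto_add[OF x(3) y(3)] x(1) y(1)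
      by (intro lim[of _ "\<lambda>n. x n + y n"]) (simp_all add: Dadd f h model_space_add bounded_part_add)
    then show "T (f + h) = T f + T h"
      using f h by (simp add: T_def model_space_add)
  next
    have "norm (T f) \<le> C * norm f" if f: "f \<in> model_space u" for f
    proof -
      from seq[OF f] obtain x where x: "\<And>n. x n \<in> bounded_part u" "x \<longlonglongrightarrow> f" "(\<lambda>n. D (x n)) \<longlonglongrightarrow> g f"
        by blast
      have "norm (g f) \<le> C * norm f"
        by (rule LIMSEQ_le[OF tendsto_norm[OF x(3)] tendsto_mult[OF tendsto_const tendsto_norm[OF x(2)]]])
          (use C(2) x(1) in auto)
      then show ?thesis using f by (simp add: T_def)
    qed
    then show "\<exists>C. \<forall>f\<in>model_space u. norm (T f) \<le> C * norm f" by blast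
  qed (simp add: T_def)
  moreover have "T f = D f" if "f \<in> bounded_part u" for f
    using that g(2) by (simp add: T_def bounded_part_model_space)
  ultimately show ?thesis by (rule that)
qed

lemma bounded_extension:
  assumes "inner_fun u" "linear_into u v D" "bounded_on u D"
  shows "bounded_operator u v (bounded_extension u v D)"
    and "f \<in> bounded_part u \<Longrightarrow> bounded_extension u v D f = D f"
proof -
  obtain T where T: "bounded_operator u v T" "\<And>f. f \<in> bounded_part u \<Longrightarrow> T f = D f"
    using bounded_extension_exists[OF assms] by blast
  then have "bounded_extension u v D = T"
    by (rule bounded_extension_eqI[OF assms(1)])
  then show "bounded_operator u v (bounded_extension u v D)"
    and "f \<in> bounded_part u \<Longrightarrow> bounded_extension u v D f = D f"
    using T by auto
qed

text \<open>The parameter is the identity for linear and complex conjugation for antilinear maps.\<close>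

definition model_iso :: "(complex \<Rightarrow> complex) \<Rightarrow> (L2 \<Rightarrow> L2) \<Rightarrow> L2 \<Rightarrow> L2 \<Rightarrow> bool" where
  "model_iso \<sigma> S a b \<longleftrightarrow>
     (\<forall>f g. S (f + g) = S f + S g) \<and> (\<forall>c f. S (cscale c f) = cscale (\<sigma> c) (S f)) \<and>
     (\<forall>f. norm (S f) = norm f) \<and> (\<forall>f. S f \<in> model_space b \<longleftrightarrow> f \<in> model_space a) \<and>
     (\<forall>f. ess_bounded (S f) \<longleftrightarrow> ess_bounded f)"

text \<open>S and R share the involution \<open>\<sigma>\<close>, so two antilinear maps around T
  give a linear operator again. Preservation of membership in both directions makes the composite
  vanish exactly where the convention wants it to.\<close>

lemma bounded_operator_transport:
  assumes S: "model_iso \<sigma> S a' a" "model_iso \<sigma> R b b'" and "\<And>c. \<sigma> (\<sigma> c) = c"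
    and T: "bounded_operator a b T"
  shows "bounded_operator a' b' (R \<circ> T \<circ> S)"
proof -
  \<comment> \<open>The scalar \<open>\<sigma> 0\<close> is used because
    \<open>\<sigma> (\<sigma> 0) = 0\<close>, whatever \<open>\<sigma> 0\<close> is. That R fixes 0
    makes the composite vanish off its source.\<close>
  have "R (cscale (\<sigma> 0) 0) = cscale (\<sigma> (\<sigma> 0)) (R 0)"
    using S(2) unfolding model_iso_def by blast
  then have "R 0 = 0" by (simp add: assms(3))
  moreover obtain C where C: "\<And>f. f \<in> model_space a \<Longrightarrow> norm (T f) \<le> C * norm f"
    using T unfolding bounded_operator_def by blast
  have "norm ((R \<circ> T \<circ> S) f) \<le> C * norm f" if "f \<in> model_space a'" for f
    using C[of "S f"] S that by (simp add: model_iso_def)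
  then have "\<exists>C. \<forall>f\<in>model_space a'. norm ((R \<circ> T \<circ> S) f) \<le> C * norm f" by blast
  moreover have "(R \<circ> T \<circ> S) f \<in> model_space b'" "(R \<circ> T \<circ> S) (cscale c f) = cscale c ((R \<circ> T \<circ> S) f)"
    if "f \<in> model_space a'" for f c
    using S T that unfolding bounded_operator_def model_iso_def by (simp_all add: assms(3))
  moreover have "(R \<circ> T \<circ> S) (f + g) = (R \<circ> T \<circ> S) f + (R \<circ> T \<circ> S) g"
    if "f \<in> model_space a'" "g \<in> model_space a'" for f g
    using S T that unfolding bounded_operator_def model_iso_def by simp
  moreover have "(R \<circ> T \<circ> S) f = 0" if "f \<notin> model_space a'" for f
    using S(1) T that \<open>R 0 = 0\<close> unfolding bounded_operator_def model_iso_def by simp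
  ultimately show ?thesis
    unfolding bounded_operator_def by blast
qed

text \<open>Lifts an identity between formulas to their extensions, with boundedness of the new
  formula as a by-product. It works because S maps bounded functions of one model space to bounded
  functions of the other.\<close>

lemma bounded_extension_transport:
  assumes a: "inner_fun a" "inner_fun a'" and D: "linear_into a b D" "bounded_on a D"
    and S: "model_iso \<sigma> S a' a" "model_iso \<sigma> R b b'" "\<And>c. \<sigma> (\<sigma> c) = c"
    and D': "\<And>f. D' f = R (D (S f))"
  shows "bounded_on a' D'" and "bounded_extension a' b' D' = R \<circ> bounded_extension a b D \<circ> S"
proof -
  let ?T = "R \<circ> bounded_extension a b D \<circ> S"
  have T: "bounded_operator a' b' ?T"
    by (rule bounded_operator_transport[OF S bounded_extension(1)[OF a(1) D]])
  have eq: "?T f = D' f" if "f \<in> bounded_part a'" for f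
  proof -
    have "S f \<in> bounded_part a"
      using S(1) that by (simp add: model_iso_def bounded_part_def)
    then show ?thesis
      using bounded_extension(2)[OF a(1) D] by (simp add: D')
  qed
  show "bounded_on a' D'" using T eq by (rule bounded_operator_bounded_on)
  show "bounded_extension a' b' D' = ?T" using a(2) T eq by (rule bounded_extension_eqI)
qed

section \<open>Relations between truncated Toeplitz and Hankel operators\<close>

text \<open>This is \<open>hat\<close> composed with the standard conjugation of the model space,
  which sends f to u times the complex conjugate of z f. Both are antilinear, so the composition is
  linear.\<close>

definition hat_flip :: "L2 \<Rightarrow> L2 \<Rightarrow> L2" where
  "hat_flip u f = hat u \<odot> flip f"

lemma hat_flip_hat_hat_flip: "unimodular u \<Longrightarrow> hat_flip (hat u) (hat_flip u f) = f"
  by (simp add: hat_flip_def flip_mult mult_conjugate_cancel)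

lemma hat_flip_hat_flip_hat: "unimodular u \<Longrightarrow> hat_flip u (hat_flip (hat u) f) = f"
  using hat_flip_hat_hat_flip[of "hat u" f] by (simp add: unimodular_hat)

lemma cinner_hat_flip: "unimodular u \<Longrightarrow> cinner (hat_flip u f) (hat_flip u g) = cinner f g"
  by (simp add: hat_flip_def cinner_mult_mult unimodular_hat cinner_flip)

lemma model_space_hat:
  assumes "f \<in> model_space u" shows "hat f \<in> model_space (hat u)"
proof -
  have "cinner (hat f) (hat u \<odot> g) = 0" if "g \<in> H2" for g
    using assms H2_hat[OF that] cinner_hat[of f "u \<odot> hat g"] by (simp add: model_space_def hat_mult)
  then show ?thesis
    using assms by (simp add: model_space_def H2_hat)
qed

text \<open>The two conditions defining a model space are interchanged: orthogonality of f to u H2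
  gives analyticity of the image, and analyticity of f gives orthogonality of the image to
  \<open>hat u\<close> times H2.\<close>

lemma model_space_hat_flip:
  assumes u: "inner_fun u" and f: "f \<in> model_space u" shows "hat_flip u f \<in> model_space (hat u)"
proof -
  note um = inner_fun_unimodular[OF u]
  have "cinner (hat_flip u f) (zpow n) = 0" if "n < 0" for n
  proof -
    \<comment> \<open>For n < 0 the exponent -n-1 is nonnegative, so the preimage of this character
      lies in u H2.\<close>
    have "zpow n = hat_flip u (u \<odot> zpow (- n - 1))"
      using um by (simp add: hat_flip_def flip_mult flip_zpow mult_conjugate_cancel unimodular_hat)
    then have "cinner (hat_flip u f) (zpow n) = cinner f (u \<odot> zpow (- n - 1))"
      using cinner_hat_flip[OF um] by metis
    also have "\<dots> = 0"
      using f that by (simp add: model_space_def H2_zpow)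
    finally show ?thesis .
  qed
  moreover have "cinner (hat_flip u f) (hat u \<odot> g) = 0" if "g \<in> H2" for g
    using um that model_space_H2[OF f]
    by (simp add: hat_flip_def cinner_mult_mult unimodular_hat cinner_flip_H2)
  ultimately show ?thesis
    by (simp add: model_space_def H2_iff)
qed

lemma model_iso_hat: "model_iso cnj hat u (hat u)"
proof -
  have "hat f \<in> model_space (hat u) \<longleftrightarrow> f \<in> model_space u" for f
    using model_space_hat[of f u] model_space_hat[of "hat f" "hat u"] by auto
  then show ?thesis
    by (simp add: model_iso_def hat_add hat_cscale ess_bounded_hat)
qed

lemma model_iso_hat_flip:
  assumes u: "inner_fun u" shows "model_iso (\<lambda>c. c) (hat_flip u) u (hat u)"
proof -
  note um = inner_fun_unimodular[OF u]
  have "f \<in> model_space u" if "hat_flip u f \<in> model_space (hat u)" for f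
    using model_space_hat_flip[OF inner_fun_hat[OF u] that] um by (simp add: hat_flip_hat_hat_flip)
  then show ?thesis
    using um model_space_hat_flip[OF u]
    by (auto simp: model_iso_def hat_flip_def flip_add flip_cscale unimodular_mult_add L2_mult_cscale unimodular_hat
      norm_unimodular_mult ess_bounded_unimodular_mult ess_bounded_flip)
qed

lemma model_iso_id: "model_iso (\<lambda>c. c) (\<lambda>f. f) u u"
  by (simp add: model_iso_def)

section \<open>Intertwining of projections and operator formulas\<close>

lemma model_proj_hat:
  assumes u: "inner_fun u" shows "model_proj (hat u) (hat g) = hat (model_proj u g)"
proof (rule model_proj_eqI)
  fix h assume "h \<in> model_space (hat u)"
  then have "hat h \<in> model_space u"
    using model_space_hat by fastforce
  then show "cinner (hat g - hat (model_proj u g)) h = 0"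
    using model_proj(2)[OF u, of "hat h" g] cinner_hat[of "g - model_proj u g" "hat h"] by (simp add: hat_diff)
qed (use u in \<open>auto simp: inner_fun_hat model_space_hat model_proj\<close>)

text \<open>A unitary that carries K_u onto the model space of \<open>hat u\<close> carries one
  orthogonal projection to the other; test vectors are pulled back by the inverse
  \<open>hat_flip (hat u)\<close>.\<close>

lemma model_proj_hat_flip:
  assumes u: "inner_fun u" shows "model_proj (hat u) (hat_flip u g) = hat_flip u (model_proj u g)"
proof (rule model_proj_eqI)
  note um = inner_fun_unimodular[OF u]
  fix h assume "h \<in> model_space (hat u)"
  then have "hat_flip (hat u) h \<in> model_space u"
    using model_space_hat_flip[OF inner_fun_hat[OF u]] by fastforce
  moreover have "hat_flip u g - hat_flip u (model_proj u g) = hat_flip u (g - model_proj u g)"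
    using model_iso_hat_flip[OF u] by (simp add: minus_L2_conv model_iso_def)
  ultimately show "cinner (hat_flip u g - hat_flip u (model_proj u g)) h = 0"
    using model_proj(2)[OF u, of "hat_flip (hat u) h" g] cinner_hat_flip[OF um, of "g - model_proj u g" "hat_flip (hat u) h"] um
    by (simp add: hat_flip_hat_flip_hat)
qed (use u in \<open>auto simp: inner_fun_hat model_space_hat_flip model_proj\<close>)

lemma toeplitz_formula_model_proj: "inner_fun v \<Longrightarrow> toeplitz_formula v \<phi> f = model_proj v (\<phi> \<odot> f)"
  by (simp add: toeplitz_formula_def orth_proj_model_space)

text \<open>The flip of an analytic function is antianalytic, so the projection I - P may be dropped.\<close>

lemma hankel_formula_model_proj:
  assumes v: "inner_fun v" shows "hankel_formula v \<phi> f = model_proj v (flip (\<phi> \<odot> f))"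
proof -
  let ?g = "\<phi> \<odot> f"
  have "model_proj v (flip ?g) = model_proj v (flip (?g - Riesz_proj ?g))"
  proof (rule model_proj_eqI[OF v model_proj(1)[OF v]])
    fix h assume h: "h \<in> model_space v"
    have "flip ?g - model_proj v (flip (?g - Riesz_proj ?g))
      = flip (Riesz_proj ?g) + (flip (?g - Riesz_proj ?g) - model_proj v (flip (?g - Riesz_proj ?g)))"
      by (simp add: flip_diff)
    then show "cinner (flip ?g - model_proj v (flip (?g - Riesz_proj ?g))) h = 0"
      using model_proj(2)[OF v h] cinner_flip_H2[OF Riesz_proj_in_H2 model_space_H2[OF h]]
      by (simp only: cinner_add_left) simp
  qed
  then show ?thesis
    by (simp add: hankel_formula_def orth_proj_H2 orth_proj_model_space[OF v])
qed

lemma linear_into_toeplitz: "inner_fun v \<Longrightarrow> linear_into u v (toeplitz_formula v \<phi>)"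
  by (simp add: linear_into_def toeplitz_formula_model_proj model_proj(1) bounded_part_def
    L2_mult_add L2_mult_cscale model_proj_add model_proj_cscale)

lemma linear_into_hankel: "inner_fun v \<Longrightarrow> linear_into u v (hankel_formula v \<phi>)"
  by (simp add: linear_into_def hankel_formula_model_proj model_proj(1) bounded_part_def
    L2_mult_add L2_mult_cscale flip_add flip_cscale model_proj_add model_proj_cscale)

lemma hat_toeplitz_formula:
  assumes "inner_fun v" shows "toeplitz_formula (hat v) (hat \<phi>) f = hat (toeplitz_formula v \<phi> (hat f))"
  using assms by (simp add: toeplitz_formula_model_proj inner_fun_hat hat_mult flip: model_proj_hat)

text \<open>Under the flip the extra factor \<open>hat v\<close> of the symbol becomes
  \<open>conjugate v\<close>, which cancels the multiplication by v inside
  \<open>hat_flip (hat v)\<close>. This map then passes through the projection.\<close>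

lemma hankel_formula_toeplitz_left:
  assumes v: "inner_fun v"
  shows "hankel_formula v \<phi> f = hat_flip (hat v) (toeplitz_formula (hat v) (hat v \<odot> \<phi>) f)"
proof -
  note um = inner_fun_unimodular[OF v]
  have "flip (\<phi> \<odot> f) = hat_flip (hat v) ((hat v \<odot> \<phi>) \<odot> f)"
    using um by (simp add: hat_flip_def L2_mult_assoc flip_mult[of "hat v"] unimodular_hat mult_conjugate_cancel)
  then show ?thesis
    using model_proj_hat_flip[OF inner_fun_hat[OF v]]
    by (simp add: hankel_formula_model_proj v toeplitz_formula_model_proj inner_fun_hat)
qed

text \<open>J turns the symbol into \<open>conjugate (hat \<phi>)\<close> and f into
  \<open>flip f\<close>; inserting \<open>conjugate (hat u)\<close> times \<open>hat u\<close>,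
  which is 1, completes \<open>flip f\<close> to \<open>hat_flip u f\<close>.\<close>

lemma hankel_formula_toeplitz_right:
  assumes u: "inner_fun u" and v: "inner_fun v"
  shows "hankel_formula v \<phi> f = toeplitz_formula v (conjugate (hat (u \<odot> \<phi>))) (hat_flip u f)"
proof -
  note um = unimodular_hat[OF inner_fun_unimodular[OF u]]
  have "conjugate (hat (u \<odot> \<phi>)) \<odot> hat_flip u f = conjugate (hat \<phi>) \<odot> flip f"
  proof -
    have "conjugate (hat (u \<odot> \<phi>)) \<odot> hat_flip u f = conjugate (hat u) \<odot> (conjugate (hat \<phi>) \<odot> (hat u \<odot> flip f))"
      using um by (simp add: hat_flip_def hat_mult conjugate_mult L2_mult_assoc unimodular_conjugate)
    \<comment> \<open>Neither the symbol nor f need be bounded, so only the unimodular factor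
      \<open>hat u\<close> is moved across.\<close>
    also have "conjugate (hat \<phi>) \<odot> (hat u \<odot> flip f) = hat u \<odot> (conjugate (hat \<phi>) \<odot> flip f)"
      using um by (metis L2_mult_assoc L2_mult_commute)
    finally show ?thesis
      using um by (simp add: conjugate_mult_cancel)
  qed
  then show ?thesis
    by (simp add: v hankel_formula_model_proj toeplitz_formula_model_proj flip_mult)
qed

section \<open>Relations between the extended operators\<close>

lemma A_op_hat:
  assumes "inner_fun u" "inner_fun v" "A_bounded u v \<phi>"
  shows "A_bounded (hat u) (hat v) (hat \<phi>)" "A_op (hat u) (hat v) (hat \<phi>) = hat \<circ> A_op u v \<phi> \<circ> hat"
proof -
  have iso: "model_iso cnj hat (hat u) u"
    using model_iso_hat[of "hat u"] by simp
  note tr = bounded_extension_transport[OF assms(1) inner_fun_hat[OF assms(1)] linear_into_toeplitz[OF assms(2)]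
      assms(3)[unfolded A_bounded_def] iso model_iso_hat complex_cnj_cnj hat_toeplitz_formula[OF assms(2)]]
  show "A_bounded (hat u) (hat v) (hat \<phi>)"
    using tr(1) by (simp add: A_bounded_def)
  show "A_op (hat u) (hat v) (hat \<phi>) = hat \<circ> A_op u v \<phi> \<circ> hat"
    using tr(2) by (simp add: A_op_def)
qed

lemma B_op_left:
  assumes "inner_fun u" "inner_fun v" "A_bounded u (hat v) (hat v \<odot> \<phi>)"
  shows "B_bounded u v \<phi>" "B_op u v \<phi> = hat_flip (hat v) \<circ> A_op u (hat v) (hat v \<odot> \<phi>)"
proof -
  have *: "linear_into u (hat v) (toeplitz_formula (hat v) (hat v \<odot> \<phi>))" 
    "bounded_on u (toeplitz_formula (hat v) (hat v \<odot> \<phi>))" "model_iso (\<lambda>c. c) (hat_flip (hat v)) (hat v) v"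
    using assms model_iso_hat_flip[OF inner_fun_hat[OF assms(2)]]
    by (simp_all add: linear_into_toeplitz inner_fun_hat A_bounded_def)
  note tr = bounded_extension_transport[OF assms(1,1) *(1,2) model_iso_id *(3) refl
      hankel_formula_toeplitz_left[OF assms(2), of \<phi>]]
  show "B_bounded u v \<phi>"
    using tr(1) by (simp add: B_bounded_def)
  show "B_op u v \<phi> = hat_flip (hat v) \<circ> A_op u (hat v) (hat v \<odot> \<phi>)"
    using tr(2) by (simp add: B_op_def A_op_def fun_eq_iff)
qed

text \<open>The relation of \<open>B_op_left\<close> solved for the Toeplitz operator. It is
  transported separately, since now boundedness of the Hankel operator is what is given.\<close>

lemma A_op_left:
  assumes u: "inner_fun u" and v: "inner_fun v" and B: "B_bounded u v \<phi>"
  shows "A_bounded u (hat v) (hat v \<odot> \<phi>)" "A_op u (hat v) (hat v \<odot> \<phi>) = hat_flip v \<circ> B_op u v \<phi>"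
proof -
  have eq: "toeplitz_formula (hat v) (hat v \<odot> \<phi>) f = hat_flip v (hankel_formula v \<phi> f)" for f
    using v by (simp add: hankel_formula_toeplitz_left hat_flip_hat_flip_hat inner_fun_unimodular)
  note tr = bounded_extension_transport[OF u u linear_into_hankel[OF v] B[unfolded B_bounded_def]
      model_iso_id model_iso_hat_flip[OF v] refl eq]
  show "A_bounded u (hat v) (hat v \<odot> \<phi>)"
    using tr(1) by (simp add: A_bounded_def)
  show "A_op u (hat v) (hat v \<odot> \<phi>) = hat_flip v \<circ> B_op u v \<phi>"
    using tr(2) by (simp add: B_op_def A_op_def fun_eq_iff)
qed

lemma B_op_right:
  assumes u: "inner_fun u" and v: "inner_fun v" and A: "A_bounded (hat u) v (conjugate (hat (u \<odot> \<phi>)))"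
  shows "B_bounded u v \<phi>" "B_op u v \<phi> = A_op (hat u) v (conjugate (hat (u \<odot> \<phi>))) \<circ> hat_flip u"
proof -
  note tr = bounded_extension_transport[OF inner_fun_hat[OF u] u linear_into_toeplitz[OF v] A[unfolded A_bounded_def]
      model_iso_hat_flip[OF u] model_iso_id refl hankel_formula_toeplitz_right[OF u v]]
  show "B_bounded u v \<phi>"
    using tr(1) by (simp add: B_bounded_def)
  show "B_op u v \<phi> = A_op (hat u) v (conjugate (hat (u \<odot> \<phi>))) \<circ> hat_flip u"
    using tr(2) by (simp add: B_op_def A_op_def fun_eq_iff)
qed

text \<open>As for the left factor, the relation is inverted at the level of formulas, using that
  \<open>hat_flip (hat u)\<close> is the inverse of \<open>hat_flip u\<close>.\<close>

lemma A_op_right: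
  assumes u: "inner_fun u" and v: "inner_fun v" and B: "B_bounded u v \<phi>"
  shows "A_bounded (hat u) v (conjugate (hat (u \<odot> \<phi>)))"
    "A_op (hat u) v (conjugate (hat (u \<odot> \<phi>))) = B_op u v \<phi> \<circ> hat_flip (hat u)"
proof -
  have eq: "toeplitz_formula v (conjugate (hat (u \<odot> \<phi>))) f = hankel_formula v \<phi> (hat_flip (hat u) f)" for f
    using u v by (simp add: hankel_formula_toeplitz_right hat_flip_hat_flip_hat inner_fun_unimodular)
  have iso: "model_iso (\<lambda>c. c) (hat_flip (hat u)) (hat u) u"
    using model_iso_hat_flip[OF inner_fun_hat[OF u]] by simp
  note tr = bounded_extension_transport[OF u inner_fun_hat[OF u] linear_into_hankel[OF v] B[unfolded B_bounded_def]
      iso model_iso_id refl eq]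
  show "A_bounded (hat u) v (conjugate (hat (u \<odot> \<phi>)))"
    using tr(1) by (simp add: A_bounded_def)
  show "A_op (hat u) v (conjugate (hat (u \<odot> \<phi>))) = B_op u v \<phi> \<circ> hat_flip (hat u)"
    using tr(2) by (simp add: B_op_def A_op_def fun_eq_iff)
qed

section \<open>Relations between the spaces of operators\<close>

lemma T_spaceI: "A_bounded u v \<phi> \<Longrightarrow> A_op u v \<phi> \<in> T_space u v"
  by (auto simp: T_space_def)

lemma H_spaceI: "B_bounded u v \<phi> \<Longrightarrow> B_op u v \<phi> \<in> H_space u v"
  by (auto simp: H_space_def)

lemma T_space_hat:
  assumes u: "inner_fun u" and v: "inner_fun v"
  shows "hat \<circ> X \<circ> hat \<in> T_space (hat u) (hat v) \<longleftrightarrow> X \<in> T_space u v"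
proof -
  have *: "hat \<circ> X \<circ> hat \<in> T_space (hat u) (hat v)" if "X \<in> T_space u v" "inner_fun u" "inner_fun v" for X u v
  proof -
    obtain \<phi> where \<phi>: "A_bounded u v \<phi>" "X = A_op u v \<phi>"
      using \<open>X \<in> T_space u v\<close> by (auto simp: T_space_def)
    then show ?thesis
      using T_spaceI[OF A_op_hat(1)[OF that(2,3) \<phi>(1)]] A_op_hat(2)[OF that(2,3) \<phi>(1)] by simp
  qed
  have "hat \<circ> (hat \<circ> X \<circ> hat) \<circ> hat = X"
    by (simp add: fun_eq_iff)
  then show ?thesis
    using *[of X u v] *[of "hat \<circ> X \<circ> hat" "hat u" "hat v"] u v by (auto simp: inner_fun_hat)
qed

text \<open>The change of symbol is multiplication by the unimodular \<open>hat v\<close>, a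
  bijection of L2, so all Toeplitz symbols are reached and the inclusion becomes an
  equivalence.\<close>

lemma H_space_left:
  assumes u: "inner_fun u" and v: "inner_fun v"
  shows "hat_flip (hat v) \<circ> X \<in> H_space u v \<longleftrightarrow> X \<in> T_space u (hat v)"
proof
  note um = inner_fun_unimodular[OF v]
  assume "hat_flip (hat v) \<circ> X \<in> H_space u v"
  then obtain \<phi> where \<phi>: "B_bounded u v \<phi>" "hat_flip (hat v) \<circ> X = B_op u v \<phi>"
    by (auto simp: H_space_def)
  have "X = hat_flip v \<circ> (hat_flip (hat v) \<circ> X)"
    using um by (simp add: fun_eq_iff hat_flip_hat_flip_hat)
  then have "X = A_op u (hat v) (hat v \<odot> \<phi>)"
    using A_op_left(2)[OF u v \<phi>(1)] \<phi>(2) by simp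
  then show "X \<in> T_space u (hat v)"
    using A_op_left(1)[OF u v \<phi>(1)] by (auto simp: T_space_def)
next
  note um = inner_fun_unimodular[OF v]
  assume "X \<in> T_space u (hat v)"
  then obtain \<psi> where \<psi>: "A_bounded u (hat v) \<psi>" "X = A_op u (hat v) \<psi>"
    by (auto simp: T_space_def)
  \<comment> \<open>The Hankel symbol is found by dividing \<open>\<psi>\<close> by the unimodular
    \<open>hat v\<close>.\<close>
  have "hat v \<odot> (conjugate (hat v) \<odot> \<psi>) = \<psi>"
    using um by (simp add: mult_conjugate_cancel unimodular_hat)
  then show "hat_flip (hat v) \<circ> X \<in> H_space u v"
    using B_op_left[OF u v, of "conjugate (hat v) \<odot> \<psi>"] H_spaceI[of u v "conjugate (hat v) \<odot> \<psi>"] \<psi> by simp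
qed

lemma H_space_right:
  assumes u: "inner_fun u" and v: "inner_fun v"
  shows "X \<circ> hat_flip u \<in> H_space u v \<longleftrightarrow> X \<in> T_space (hat u) v"
proof
  note um = inner_fun_unimodular[OF u]
  assume "X \<circ> hat_flip u \<in> H_space u v"
  then obtain \<phi> where \<phi>: "B_bounded u v \<phi>" "X \<circ> hat_flip u = B_op u v \<phi>"
    by (auto simp: H_space_def)
  have "X = X \<circ> hat_flip u \<circ> hat_flip (hat u)"
    using um by (simp add: fun_eq_iff hat_flip_hat_flip_hat)
  then have "X = A_op (hat u) v (conjugate (hat (u \<odot> \<phi>)))"
    using A_op_right(2)[OF u v \<phi>(1)] \<phi>(2) by simp
  then show "X \<in> T_space (hat u) v"
    using A_op_right(1)[OF u v \<phi>(1)] by (auto simp: T_space_def)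
next
  note um = inner_fun_unimodular[OF u]
  assume "X \<in> T_space (hat u) v"
  then obtain \<psi> where \<psi>: "A_bounded (hat u) v \<psi>" "X = A_op (hat u) v \<psi>"
    by (auto simp: T_space_def)
  \<comment> \<open>The witness solves \<open>conjugate (hat (u \<odot> \<phi>)) = \<psi>\<close>
    for \<open>\<phi>\<close>: undo conjugation and hat, then divide by u.\<close>
  have "conjugate (hat (u \<odot> (conjugate u \<odot> conjugate (hat \<psi>)))) = \<psi>"
    using um by (simp add: mult_conjugate_cancel hat_conjugate)
  then show "X \<circ> hat_flip u \<in> H_space u v"
    using B_op_right[OF u v, of "conjugate u \<odot> conjugate (hat \<psi>)"]
      H_spaceI[of u v "conjugate u \<odot> conjugate (hat \<psi>)"] \<psi> by simp
qed

text \<open>Conjugating by \<open>hat\<close> changes the symbol \<open>hat v \<odot> \<phi>\<close>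
  of \<open>A_op_left\<close> into \<open>v \<odot> hat \<phi>\<close>, the shape required of one
  Toeplitz factor in each product. The other shape comes from \<open>A_op_right\<close> in the same
  way.\<close>

lemma A_op_from_B_op_left:
  assumes u: "inner_fun u" and v: "inner_fun v" and B: "B_bounded u v \<phi>"
  shows "A_bounded (hat u) v (v \<odot> hat \<phi>)" "A_op (hat u) v (v \<odot> hat \<phi>) = hat \<circ> hat_flip v \<circ> B_op u v \<phi> \<circ> hat"
  using A_op_hat[OF u inner_fun_hat[OF v] A_op_left(1)[OF assms]]
  by (simp_all add: hat_mult A_op_left(2)[OF assms] comp_assoc)

lemma A_op_from_B_op_right:
  assumes u: "inner_fun u" and v: "inner_fun v" and B: "B_bounded u v \<phi>"
  shows "A_bounded u (hat v) (conjugate (u \<odot> \<phi>))"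
    "A_op u (hat v) (conjugate (u \<odot> \<phi>)) = hat \<circ> B_op u v \<phi> \<circ> hat_flip (hat u) \<circ> hat"
  using A_op_hat[OF inner_fun_hat[OF u] v A_op_right(1)[OF assms]]
  by (simp_all add: hat_conjugate A_op_right(2)[OF assms] comp_assoc)

text \<open>\<open>A_op\<close> and \<open>B_op\<close> have meaning only for bounded operators, so
  boundedness of the five operators that do not occur in the assumptions belongs to the conclusion.
  The four conditions are linked by a chain of three equivalences.\<close>

theorem corollary3p6:
  fixes u v w \<phi>1 \<phi>2 :: L2
  assumes "inner_fun u" and "nonconstant u"
    and "inner_fun v" and "nonconstant v"
    and "inner_fun w" and "nonconstant w"
    and "B_bounded v w \<phi>1" and "B_bounded u v \<phi>2"
  shows
    "(A_bounded (hat v) w (w \<odot> hat \<phi>1) \<and> A_bounded u (hat v) (conjugate (u \<odot> \<phi>2)) \<and>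
      A_bounded v (hat w) (conjugate (v \<odot> \<phi>1)) \<and> A_bounded (hat u) v (v \<odot> hat \<phi>2) \<and>
      B_bounded v w (conjugate (v \<odot> hat w \<odot> \<phi>1))) \<and>
     (B_op v w \<phi>1 \<circ> B_op u v \<phi>2 \<in> T_space u w
       \<longleftrightarrow> A_op (hat v) w (w \<odot> hat \<phi>1) \<circ> A_op u (hat v) (conjugate (u \<odot> \<phi>2)) \<in> T_space u w) \<and>
     (A_op (hat v) w (w \<odot> hat \<phi>1) \<circ> A_op u (hat v) (conjugate (u \<odot> \<phi>2)) \<in> T_space u w
       \<longleftrightarrow> A_op v (hat w) (conjugate (v \<odot> \<phi>1)) \<circ> A_op (hat u) v (v \<odot> hat \<phi>2)
             \<in> T_space (hat u) (hat w)) \<and>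
     (A_op v (hat w) (conjugate (v \<odot> \<phi>1)) \<circ> A_op (hat u) v (v \<odot> hat \<phi>2)
             \<in> T_space (hat u) (hat w)
       \<longleftrightarrow> B_op v w (conjugate (v \<odot> hat w \<odot> \<phi>1)) \<circ> A_op (hat u) v (v \<odot> hat \<phi>2)
             \<in> H_space (hat u) w)"
proof -
  note u = \<open>inner_fun u\<close> and v = \<open>inner_fun v\<close> and w = \<open>inner_fun w\<close>
  note B1 = \<open>B_bounded v w \<phi>1\<close> and B2 = \<open>B_bounded u v \<phi>2\<close>
  note A1l = A_op_from_B_op_left[OF v w B1] and A1r = A_op_from_B_op_right[OF v w B1]
  note A2l = A_op_from_B_op_left[OF u v B2] and A2r = A_op_from_B_op_right[OF u v B2]
  note um = inner_fun_unimodular[OF u] inner_fun_unimodular[OF v] inner_fun_unimodular[OF w]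
  define X where "X = B_op v w \<phi>1 \<circ> B_op u v \<phi>2"
  have "v \<odot> hat w \<odot> \<phi>1 = hat w \<odot> (v \<odot> \<phi>1)"
    using um by (metis L2_mult_assoc L2_mult_commute unimodular_hat)
  \<comment> \<open>The factor \<open>hat w\<close> in the symbol of (4) is there to be cancelled:
    what remains is the symbol of the first Toeplitz factor in (3).\<close>
  then have sym4: "hat w \<odot> conjugate (v \<odot> hat w \<odot> \<phi>1) = conjugate (v \<odot> \<phi>1)"
    using um by (simp add: conjugate_mult[of "hat w"] mult_conjugate_cancel unimodular_hat)
  have B4: "B_bounded v w (conjugate (v \<odot> hat w \<odot> \<phi>1))"
    "B_op v w (conjugate (v \<odot> hat w \<odot> \<phi>1)) = hat_flip (hat w) \<circ> A_op v (hat w) (conjugate (v \<odot> \<phi>1))"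
    using B_op_left[OF v w, of "conjugate (v \<odot> hat w \<odot> \<phi>1)"] A1r(1) by (simp_all add: sym4)
  \<comment> \<open>The two copies of \<open>hat\<close> over the middle space cancel and the
    \<open>hat_flip\<close> maps stand only at the outer ends.\<close>
  have X2: "A_op (hat v) w (w \<odot> hat \<phi>1) \<circ> A_op u (hat v) (conjugate (u \<odot> \<phi>2))
      = hat \<circ> (hat_flip w \<circ> X \<circ> hat_flip (hat u)) \<circ> hat"
    by (simp add: A1l A2r X_def fun_eq_iff)
  \<comment> \<open>Here \<open>hat_flip (hat v)\<close> meets \<open>hat_flip v\<close> in the
    middle once the two copies of \<open>hat\<close> between them have cancelled, so no
    \<open>hat_flip\<close> is left.\<close>
  have X3: "A_op v (hat w) (conjugate (v \<odot> \<phi>1)) \<circ> A_op (hat u) v (v \<odot> hat \<phi>2) = hat \<circ> X \<circ> hat"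
    using um by (simp add: A1r A2l X_def fun_eq_iff hat_flip_hat_hat_flip)
  \<comment> \<open>After the outer \<open>hat\<close> maps are removed, the two
    \<open>hat_flip\<close> maps are stripped one at a time: the first passes from Toeplitz to
    Hankel operators, the second back to Toeplitz operators.\<close>
  have "hat \<circ> (hat_flip w \<circ> X \<circ> hat_flip (hat u)) \<circ> hat \<in> T_space u w \<longleftrightarrow> hat_flip w \<circ> X \<circ> hat_flip (hat u) \<in> T_space (hat u) (hat w)"
    using T_space_hat[OF inner_fun_hat[OF u] inner_fun_hat[OF w], of "hat_flip w \<circ> X \<circ> hat_flip (hat u)"] by simp
  also have "\<dots> \<longleftrightarrow> hat_flip (hat w) \<circ> (hat_flip w \<circ> X \<circ> hat_flip (hat u)) \<in> H_space (hat u) w"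
    using H_space_left[OF inner_fun_hat[OF u] w] by simp
  also have "hat_flip (hat w) \<circ> (hat_flip w \<circ> X \<circ> hat_flip (hat u)) = X \<circ> hat_flip (hat u)"
    using um by (simp add: fun_eq_iff hat_flip_hat_hat_flip)
  also have "X \<circ> hat_flip (hat u) \<in> H_space (hat u) w \<longleftrightarrow> X \<in> T_space u w"
    using H_space_right[OF inner_fun_hat[OF u] w] by simp
  finally have E12: "hat \<circ> (hat_flip w \<circ> X \<circ> hat_flip (hat u)) \<circ> hat \<in> T_space u w \<longleftrightarrow> X \<in> T_space u w" .
  have E13: "hat \<circ> X \<circ> hat \<in> T_space (hat u) (hat w) \<longleftrightarrow> X \<in> T_space u w"
    by (rule T_space_hat[OF u w])
  \<comment> \<open>By \<open>B4\<close> and \<open>X3\<close> the product in (4) is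
    \<open>hat_flip (hat w)\<close> applied after the product in (3), so a single exchange is
    enough.\<close>
  have E34: "B_op v w (conjugate (v \<odot> hat w \<odot> \<phi>1)) \<circ> A_op (hat u) v (v \<odot> hat \<phi>2) \<in> H_space (hat u) w
      \<longleftrightarrow> hat \<circ> X \<circ> hat \<in> T_space (hat u) (hat w)"
    unfolding B4(2) comp_assoc[of "hat_flip (hat w)"] X3 by (rule H_space_left[OF inner_fun_hat[OF u] w])
  show ?thesis
    unfolding X2 X3 E12 E13 E34 X_def[symmetric] using A1l(1) A1r(1) A2l(1) A2r(1) B4(1) by blast
qed

end
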